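(* (i) For every integer $k\geq 2$ there exists an ergodic measure preserving system $(X,\mathcal{B},\mu,T)$ such that $\mathcal{E}_k(T)^\perp\neq\mathcal{E}_k(T^2)^\perp$. (ii) For every integer $k\geq 2$ there exist an ergodic (but not totally ergodic) measure preserving system $(X,\mathcal{B},\mu,T)$ and a function $f\in L^\infty(\mu)$ with $f\in\mathcal{E}_k(T)^\perp$ such that the following fails: for $\mu$-a.e. $x\in X$, for every continuous $\phi\colon\mathbb{T}\to\mathbb{C}$ and every $P\in\mathbb{R}_k[t]$, $\lim_{N\to\infty}\frac1N\sum_{n=1}^N\phi(P(n))f(T^nx)=0$. Consequently, the equivalence of the conditions "(i) $f\in\mathcal{E}_k(T)^\perp$", "(ii) for a.e. $x$, for all continuous $\phi$ and $P\in\mathbb{R}_k[t]$, $\lim_{N}\frac1N\sum_{n=1}^N\phi(P(n))f(T^nx)=0$", and "(iii) for a.e. $x$, for all continuous $\phi$, $\lim_N\sup_{P\in\mathbb{R}_k[t]}|\frac1N\sum_{n=1}^N\phi(P(n))f(T^nx)|=0$", which holds for totally ergodic systems, fails in general when total ergodicity is replaced by ergodicity.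
   Context: A measure preserving system consists of a probability space $(X,\mathcal{B},\mu)$ and a measure preserving map $T$; $Tf=f\circ T$. A system is ergodic if every $T$-invariant set has measure $0$ or $1$, and totally ergodic if $T^r$ is ergodic for all $r\in\mathbb{N}$. $\mathbb{T}=\mathbb{R}/\mathbb{Z}$. $\mathbb{R}_k[t]$ is the set of real polynomials of degree at most $k$. For an ergodic system $(X,\mathcal{B},\mu,S)$, $\mathcal{E}_0(S)$ is the set of eigenvalues of $S$, and inductively $\mathcal{E}_k(S)=\{f\in L^\infty(\mu):|f|=1,\ f\circ S\cdot\bar f\in\mathcal{E}_{k-1}(S)\}$; $\mathcal{E}_k(S)^\perp$ is the set of $f\in L^1(\mu)$ with $\int f\bar g\,d\mu=0$ for all $g\in\mathcal{E}_k(S)$. (For $S=T^2$, which need not be ergodic, the same inductive definition is used with $\mathcal{E}_0(T^2)$ the set of eigenvalues of $T^2$.) *)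

theory Defs
  imports "HOL-Probability.Probability" "HOL-Computational_Algebra.Polynomial"
begin

definition mps :: "'a measure \<Rightarrow> ('a \<Rightarrow> 'a) \<Rightarrow> bool" where
  "mps M T \<longleftrightarrow> prob_space M \<and> T \<in> measurable M M \<and> distr M M T = M"

definition ergodic :: "'a measure \<Rightarrow> ('a \<Rightarrow> 'a) \<Rightarrow> bool" where
  "ergodic M T \<longleftrightarrow> mps M T \<and>
     (\<forall>A\<in>sets M. T -` A \<inter> space M = A \<longrightarrow> measure M A = 0 \<or> measure M A = 1)"

definition totally_ergodic :: "'a measure \<Rightarrow> ('a \<Rightarrow> 'a) \<Rightarrow> bool" where
  "totally_ergodic M T \<longleftrightarrow> (\<forall>r::nat. r \<ge> 1 \<longrightarrow> ergodic M (T ^^ r))"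

definition eigenvalue :: "'a measure \<Rightarrow> ('a \<Rightarrow> 'a) \<Rightarrow> complex \<Rightarrow> bool" where
  "eigenvalue M S c \<longleftrightarrow> (\<exists>f. f \<in> borel_measurable M \<and>
     integrable M (\<lambda>x. (cmod (f x))\<^sup>2) \<and> \<not> (AE x in M. f x = 0) \<and>
     (AE x in M. f (S x) = c * f x))"

text \<open>E_k(S) as a set of functions (closed under a.e. equality); E_0(S) consists of the
  (a.e.) constant functions whose value is an eigenvalue of S.\<close>
fun E :: "'a measure \<Rightarrow> nat \<Rightarrow> ('a \<Rightarrow> 'a) \<Rightarrow> ('a \<Rightarrow> complex) set" where
  "E M 0 S = {f. f \<in> borel_measurable M \<and>
       (\<exists>c. eigenvalue M S c \<and> (AE x in M. f x = c))}"
| "E M (Suc k) S = {f. f \<in> borel_measurable M \<and> (AE x in M. cmod (f x) = 1) \<and>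
       (\<lambda>x. f (S x) * cnj (f x)) \<in> E M k S}"

definition E_perp :: "'a measure \<Rightarrow> nat \<Rightarrow> ('a \<Rightarrow> 'a) \<Rightarrow> ('a \<Rightarrow> complex) set" where
  "E_perp M k S = {f. integrable M f \<and>
       (\<forall>g\<in>E M k S. (LINT x|M. f x * cnj (g x)) = 0)}"

definition torus_cont :: "(real \<Rightarrow> complex) \<Rightarrow> bool" where
  "torus_cont \<phi> \<longleftrightarrow> continuous_on UNIV \<phi> \<and> (\<forall>t. \<phi> (t + 1) = \<phi> t)"

definition Linfty :: "'a measure \<Rightarrow> ('a \<Rightarrow> complex) \<Rightarrow> bool" where
  "Linfty M f \<longleftrightarrow> f \<in> borel_measurable M \<and> (\<exists>C. AE x in M. cmod (f x) \<le> C)"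

end

theory Submission
  imports Defs
begin

text \<open>
  Let \<open>S\<close> be the skew product \<open>(x\<^sub>1, x\<^sub>2, x\<^sub>3, \<dots>) \<mapsto> (x\<^sub>1 + \<alpha>, x\<^sub>2 + x\<^sub>1, x\<^sub>3 + x\<^sub>2, \<dots>)\<close> on the infinite torus,
  with \<open>\<alpha>\<close> irrational, and let \<open>T\<close> be the tower of height two over \<open>S\<close>, so that \<open>T\<^sup>2\<close> acts as \<open>S\<close> on both
  floors. The function \<open>e(x\<^sub>k)\<close> has constant \<open>k\<close>-th multiplicative \<open>S\<close>-difference \<open>e(\<alpha>)\<close>. If \<open>h \<in> E\<^sub>k(T)\<close> has
  \<open>k\<close>-th \<open>T\<close>-difference \<open>c\<close>, its \<open>k\<close>-th \<open>S\<close>-difference is \<open>c\<close> to the power \<open>2\<^sup>k\<close>; as \<open>c\<^sup>2 = e(m\<alpha>)\<close> for an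
  integer \<open>m\<close> and \<open>k \<ge> 2\<close>, this is an even power of \<open>e(\<alpha>)\<close>. So the \<open>k\<close>-th \<open>S\<close>-difference of \<open>e(x\<^sub>k)\<close> times the
  conjugate of \<open>h\<close> is not a root of unity, and van der Corput's argument makes \<open>e(x\<^sub>k)\<close> orthogonal to \<open>h\<close>,
  also after restriction to the lower floor. Yet \<open>e(x\<^sub>k) \<in> E\<^sub>k(T\<^sup>2)\<close>, and along the even times the orbit of a
  point of the lower floor reads off a polynomial phase of degree \<open>k\<close>, which a suitable \<open>P\<close> cancels.
\<close>

section \<open>Fourier uniqueness\<close>

definition e2pi :: "real \<Rightarrow> complex" where
  "e2pi t = cis (2 * pi * t)"

lemma norm_e2pi [simp]: "cmod (e2pi t) = 1"
  by (simp add: e2pi_def)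

lemma e2pi_0 [simp]: "e2pi 0 = 1"
  by (simp add: e2pi_def)

lemma e2pi_add: "e2pi (s + t) = e2pi s * e2pi t"
  by (simp add: e2pi_def cis_mult algebra_simps)

lemma e2pi_minus: "e2pi (- t) = cnj (e2pi t)"
  by (simp add: e2pi_def cis_cnj)

lemma e2pi_mult_cnj [simp]: "e2pi t * cnj (e2pi t) = 1" "cnj (e2pi t) * e2pi t = 1"
  by (metis complex_mod_mult_cnj complex_norm_square norm_e2pi of_real_1 power_one mult.commute)+

lemma e2pi_eq_1_iff: "e2pi t = 1 \<longleftrightarrow> t \<in> \<int>"
proof
  assume "e2pi t = 1"
  then have "cos (2 * pi * t) = 1"
    by (metis Re_complex_of_real cis.simps(1) e2pi_def of_real_1)
  then obtain n :: int where "2 * pi * t = n * 2 * pi"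
    using cos_one_2pi_int by auto
  then show "t \<in> \<int>" by simp
next
  assume "t \<in> \<int>"
  then obtain n where "t = of_int n" by (elim Ints_cases)
  then show "e2pi t = 1"
    using cis_multiple_2pi[of t] by (simp add: e2pi_def)
qed

lemma e2pi_eq_iff: "e2pi s = e2pi t \<longleftrightarrow> s - t \<in> \<int>"
proof -
  have "e2pi s = e2pi (s - t) * e2pi t"
    by (metis diff_add_cancel e2pi_add)
  moreover have "e2pi t \<noteq> 0"
    by (metis norm_e2pi norm_zero zero_neq_one)
  ultimately show ?thesis
    by (simp flip: e2pi_eq_1_iff)
qed

lemma e2pi_of_int [simp]: "e2pi (of_int n) = 1"
  by (simp add: e2pi_eq_1_iff)

lemma e2pi_int_mult_frac: "e2pi (of_int n * frac t) = e2pi (of_int n * t)"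
  by (simp add: e2pi_eq_iff frac_def algebra_simps)

lemma e2pi_frac [simp]: "e2pi (frac t) = e2pi t"
  using e2pi_int_mult_frac[of 1] by simp

lemma e2pi_power: "e2pi t ^ n = e2pi (of_nat n * t)"
  by (simp add: e2pi_def Complex.DeMoivre mult.left_commute)

lemma continuous_on_e2pi [continuous_intros]:
  "continuous_on A f \<Longrightarrow> continuous_on A (\<lambda>x. e2pi (f x))"
  unfolding e2pi_def cis_conv_exp by (intro continuous_intros)

lemma borel_measurable_e2pi [measurable]: "e2pi \<in> borel_measurable borel"
  by (intro borel_measurable_continuous_onI continuous_intros continuous_on_id)

text \<open>Induction over the generation of polynomial functions. On the unit circle conjugation is
  inversion, so a real-linear map only shifts frequencies by 1 and -1, and agreement at all
  frequencies is preserved. The weights \<open>G\<close> and \<open>H\<close> are arbitrary so that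
  in a product one factor can be absorbed into them.\<close>

lemma real_polynomial_function_fourier:
  assumes "real_polynomial_function p"
    and [measurable]: "X \<in> borel_measurable M" "Y \<in> borel_measurable N"
    and "integrable M G" "integrable N H"
    and "\<And>n::int. (LINT x|M. G x * e2pi (of_int n * X x)) = (LINT y|N. H y * e2pi (of_int n * Y y))"
  shows "integrable M (\<lambda>x. G x * of_real (p (e2pi (X x))))" (is ?A)
    and "integrable N (\<lambda>y. H y * of_real (p (e2pi (Y y))))" (is ?B)
    and "(LINT x|M. G x * of_real (p (e2pi (X x))) * e2pi (of_int n * X x)) =
      (LINT y|N. H y * of_real (p (e2pi (Y y))) * e2pi (of_int n * Y y))" (is ?C)
proof -
  have ie: "integrable M (\<lambda>x. G x * e2pi (f x))" if "integrable M G" and [measurable]: "f \<in> borel_measurable M"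
    for G and M :: "'x measure" and f
    by (rule Bochner_Integration.integrable_bound[OF that(1)])
      (use that in \<open>auto simp: norm_mult\<close>)
  have "?A \<and> ?B \<and> (\<forall>n. (LINT x|M. G x * of_real (p (e2pi (X x))) * e2pi (of_int n * X x)) =
      (LINT y|N. H y * of_real (p (e2pi (Y y))) * e2pi (of_int n * Y y)))"
    using assms(1,4-6)
  proof (induction p arbitrary: G H)
    case (linear l)
    interpret l: bounded_linear l by fact
    \<comment> \<open>The Wirtinger coefficients of \<open>l\<close>: a real-linear map on the plane
      is a combination of \<open>z\<close> and \<open>cnj z\<close>.\<close>
    define a where "a = (complex_of_real (l 1) - \<i> * of_real (l \<i>)) / 2"
    define b where "b = (complex_of_real (l 1) + \<i> * of_real (l \<i>)) / 2"
    have l: "complex_of_real (l z) = a * z + b * cnj z" for z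
    proof -
      have "z = Re z *\<^sub>R 1 + Im z *\<^sub>R \<i>" by (simp add: complex_eq_iff)
      then have "l z = Re z * l 1 + Im z * l \<i>"
        by (metis l.add l.scaleR real_scaleR_def)
      then show ?thesis
        by (simp add: a_def b_def complex_eq_iff field_simps)
    qed
    have eq: "G * of_real (l (e2pi t)) * e2pi (of_int n * t) =
        a * (G * e2pi (of_int (n + 1) * t)) + b * (G * e2pi (of_int (n - 1) * t))" for G n t
    proof -
      have "e2pi (of_int (n + 1) * t) = e2pi (of_int n * t) * e2pi t"
        by (simp add: e2pi_add ring_distribs)
      moreover have "e2pi (of_int (n - 1) * t) = e2pi (of_int n * t) * cnj (e2pi t)"
        by (simp flip: e2pi_minus e2pi_add add: algebra_simps)
      ultimately show ?thesis by (simp add: l algebra_simps)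
    qed
    have eq0: "G * of_real (l (e2pi t)) =
        a * (G * e2pi (of_int 1 * t)) + b * (G * e2pi (of_int (-1) * t))" for G t
      using eq[of G t 0] by simp
    show ?case
      unfolding eq unfolding eq0 using linear(2-4) by (simp add: ie del: of_int_add of_int_diff of_int_minus)
  next
    case (const c)
    have eq: "G * of_real c * e2pi t = of_real c * (G * e2pi t)" for G t by simp
    show ?case unfolding eq using const by simp
  next
    case (add p q)
    have ie': "integrable M (\<lambda>x. G x * c x * e2pi (f x))"
      if "integrable M (\<lambda>x. G x * c x)" and [measurable]: "f \<in> borel_measurable M"
      for G c and M :: "'x measure" and f
      using that by (rule ie)
    show ?case
      using add.IH(1)[OF add.prems] add.IH(2)[OF add.prems]
      by (simp add: ring_distribs ie')
  next
    case (mult p q)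
    note p = mult.IH(1)[OF mult.prems]
    \<comment> \<open>The hypothesis on \<open>q\<close> is applied to the weights already
      multiplied by \<open>p\<close>.\<close>
    have "integrable M (\<lambda>x. (G x * of_real (p (e2pi (X x)))) * of_real (q (e2pi (X x)))) \<and>
       integrable N (\<lambda>y. (H y * of_real (p (e2pi (Y y)))) * of_real (q (e2pi (Y y)))) \<and>
       (\<forall>n. (LINT x|M. (G x * of_real (p (e2pi (X x)))) * of_real (q (e2pi (X x))) * e2pi (of_int n * X x)) =
          (LINT y|N. (H y * of_real (p (e2pi (Y y)))) * of_real (q (e2pi (Y y))) * e2pi (of_int n * Y y)))"
      by (rule mult.IH(2)) (use p in auto)
    then show ?case by (simp add: mult.assoc)
  qed
  then show ?A ?B ?C by auto
qed

lemma inj_on_e2pi: "inj_on e2pi {0..<1}"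
proof (rule inj_onI)
  fix s t :: real assume st: "s \<in> {0..<1}" "t \<in> {0..<1}" "e2pi s = e2pi t"
  then obtain n :: int where n: "s - t = n" by (auto simp: e2pi_eq_iff elim: Ints_cases)
  with st have "\<bar>real_of_int n\<bar> < 1" by auto
  then have "n = 0" by linarith
  with n show "s = t" by simp
qed

text \<open>Stone-Weierstrass on the unit circle: a polynomial uniformly close to \<open>F\<close>
  changes either integral by at most a small multiple of the L1 norm of its weight.\<close>

lemma continuous_fourier:
  fixes F :: "complex \<Rightarrow> real"
  assumes F: "continuous_on UNIV F"
    and [measurable]: "X \<in> borel_measurable M" "Y \<in> borel_measurable N"
    and G: "integrable M G" and H: "integrable N H"
    and eq: "\<And>n::int. (LINT x|M. G x * e2pi (of_int n * X x)) = (LINT y|N. H y * e2pi (of_int n * Y y))"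
  shows "(LINT x|M. G x * of_real (F (e2pi (X x)))) = (LINT y|N. H y * of_real (F (e2pi (Y y))))"
proof -
  define K where "K = (LINT x|M. cmod (G x)) + (LINT y|N. cmod (H y))"
  have K: "K \<ge> 0" by (simp add: K_def)
  have [measurable]: "F \<in> borel_measurable borel"
    by (rule borel_measurable_continuous_onI) fact
  have "compact (F ` sphere 0 1)"
    by (intro compact_continuous_image continuous_on_subset[OF F]) auto
  then obtain B where B: "\<And>z. cmod z = 1 \<Longrightarrow> \<bar>F z\<bar> \<le> B"
    using compact_imp_bounded[of "F ` sphere 0 1"]
    by (auto simp: bounded_iff) (metis mem_sphere_0)
  have iF: "integrable L (\<lambda>x. Q x * of_real (F (e2pi (Z x))))"
    if "integrable L Q" and [measurable]: "Z \<in> borel_measurable L" for L :: "'x measure" and Q :: "'x \<Rightarrow> complex" and Z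
  proof (rule Bochner_Integration.integrable_bound)
    show "integrable L (\<lambda>x. Q x * complex_of_real B)" using that by simp
    show "AE x in L. norm (Q x * of_real (F (e2pi (Z x)))) \<le> norm (Q x * complex_of_real B)"
      using B[OF norm_e2pi] by (auto simp: norm_mult intro!: AE_I2 mult_left_mono order_trans[OF _ abs_ge_self])
  qed (use that in simp)
  have est: "cmod ((LINT x|L. Q x * of_real (F (e2pi (Z x)))) - (LINT x|L. Q x * of_real (p (e2pi (Z x)))))
        \<le> \<epsilon> * (LINT x|L. cmod (Q x))"
    if Q: "integrable L Q" and Z: "Z \<in> borel_measurable L" and
      p: "integrable L (\<lambda>x. Q x * of_real (p (e2pi (Z x))))"
      "\<And>z. z \<in> sphere 0 1 \<Longrightarrow> \<bar>F z - p z\<bar> < \<epsilon>"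
    for L :: "'x measure" and Q Z p \<epsilon>
  proof -
    have "cmod ((LINT x|L. Q x * of_real (F (e2pi (Z x)))) - (LINT x|L. Q x * of_real (p (e2pi (Z x)))))
      = cmod (LINT x|L. Q x * of_real (F (e2pi (Z x))) - Q x * of_real (p (e2pi (Z x))))"
      by (subst Bochner_Integration.integral_diff) (use iF[OF Q Z] Q p in auto)
    also have "\<dots> \<le> (LINT x|L. cmod (Q x * of_real (F (e2pi (Z x))) - Q x * of_real (p (e2pi (Z x)))))"
      by (rule integral_norm_bound)
    also have "\<dots> \<le> (LINT x|L. \<epsilon> * cmod (Q x))"
    proof (rule integral_mono)
      fix x
      have "cmod (Q x * of_real (F (e2pi (Z x))) - Q x * of_real (p (e2pi (Z x)))) =
        cmod (Q x) * \<bar>F (e2pi (Z x)) - p (e2pi (Z x))\<bar>"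
        by (simp flip: right_diff_distrib of_real_diff add: norm_mult)
      also have "\<dots> \<le> cmod (Q x) * \<epsilon>"
        by (rule mult_left_mono[OF less_imp_le[OF p(2)]]) auto
      finally show "cmod (Q x * of_real (F (e2pi (Z x))) - Q x * of_real (p (e2pi (Z x)))) \<le> \<epsilon> * cmod (Q x)"
        by (simp add: mult.commute)
    qed (use iF[OF Q Z] Q p in auto)
    finally show ?thesis using Q by simp
  qed
  have "cmod ((LINT x|M. G x * of_real (F (e2pi (X x)))) - (LINT y|N. H y * of_real (F (e2pi (Y y))))) \<le> 0 + \<epsilon>"
    if \<epsilon>: "\<epsilon> > 0" for \<epsilon>
  proof -
    \<comment> \<open>Adding 1 to \<open>K\<close> keeps the quotient meaningful when both weights
      vanish almost everywhere.\<close>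
    define \<delta> where "\<delta> = \<epsilon> / (K + 1)"
    have \<delta>: "\<delta> > 0" "\<delta> * K \<le> \<epsilon>" using K \<epsilon> by (auto simp: \<delta>_def field_simps)
    obtain p where p: "real_polynomial_function p" "\<And>z. z \<in> sphere 0 1 \<Longrightarrow> \<bar>F z - p z\<bar> < \<delta>"
      using Stone_Weierstrass_real_polynomial_function[OF _ continuous_on_subset[OF F] \<delta>(1), of "sphere 0 1"]
      by auto
    note rp = real_polynomial_function_fourier[OF p(1) assms(2-6)]
    have pp: "(LINT x|M. G x * of_real (p (e2pi (X x)))) = (LINT y|N. H y * of_real (p (e2pi (Y y))))"
      using rp(3)[of 0] by simp
    have "cmod ((LINT x|M. G x * of_real (F (e2pi (X x)))) - (LINT y|N. H y * of_real (F (e2pi (Y y)))))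
      \<le> \<delta> * (LINT x|M. cmod (G x)) + \<delta> * (LINT x|N. cmod (H x))"
      using est[OF G _ rp(1) p(2)] est[OF H _ rp(2) p(2)] unfolding pp
      by (smt (verit, best) assms(2,3) norm_minus_commute norm_triangle_ineq norm_diff_triangle_le)
    also have "\<dots> \<le> \<epsilon>" using \<delta> by (simp add: K_def algebra_simps)
    finally show ?thesis by simp
  qed
  then have "cmod ((LINT x|M. G x * of_real (F (e2pi (X x)))) - (LINT y|N. H y * of_real (F (e2pi (Y y))))) \<le> 0"
    by (rule field_le_epsilon)
  then show ?thesis by simp
qed

text \<open>The indicator of a closed arc is a pointwise limit of continuous functions, so dominated
  convergence applies. As \<open>X\<close> and \<open>Y\<close> take values in [0,1), where
  \<open>e2pi\<close> is injective, lying on the arc is the same as being at most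
  \<open>a\<close>.\<close>

lemma interval_fourier:
  assumes [measurable]: "X \<in> borel_measurable M" "Y \<in> borel_measurable N"
    and X: "\<And>x. x \<in> space M \<Longrightarrow> X x \<in> {0..<1}" and Y: "\<And>y. y \<in> space N \<Longrightarrow> Y y \<in> {0..<1}"
    and G: "integrable M G" and H: "integrable N H"
    and eq: "\<And>n::int. (LINT x|M. G x * e2pi (of_int n * X x)) = (LINT y|N. H y * e2pi (of_int n * Y y))"
  shows "(LINT x|M. G x * of_bool (X x \<le> a)) = (LINT y|N. H y * of_bool (Y y \<le> a))"
proof -
  consider "a < 0" | "0 \<le> a" "a < 1" | "a \<ge> 1" by linarith
  then show ?thesis
  proof cases
    case 1
    have "(LINT x|M. G x * of_bool (X x \<le> a)) = (LINT x|M. 0)"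
      using 1 X by (intro Bochner_Integration.integral_cong refl) fastforce
    moreover have "(LINT y|N. H y * of_bool (Y y \<le> a)) = (LINT y|N. 0)"
      using 1 Y by (intro Bochner_Integration.integral_cong refl) fastforce
    ultimately show ?thesis by simp
  next
    case 3
    have "(LINT x|M. G x * of_bool (X x \<le> a)) = (LINT x|M. G x)"
      using 3 X by (intro Bochner_Integration.integral_cong refl) fastforce
    moreover have "(LINT y|N. H y * of_bool (Y y \<le> a)) = (LINT y|N. H y)"
      using 3 Y by (intro Bochner_Integration.integral_cong refl) fastforce
    ultimately show ?thesis using eq[of 0] by simp
  next
    case 2
    define K where "K = e2pi ` {0..a}"
    have "compact K" unfolding K_def
      by (intro compact_continuous_image continuous_intros) auto
    then have K: "closed K" "K \<noteq> {}" using 2 by (auto simp: K_def compact_imp_closed)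
    \<comment> \<open>Tent functions of slope \<open>j\<close> around the closed arc
      \<open>K\<close>; they decrease to its indicator.\<close>
    define F where "F = (\<lambda>(j::nat) z. max 0 (1 - real j * infdist z K))"
    have F01: "0 \<le> F j z" "F j z \<le> 1" for j z
      by (auto simp: F_def infdist_nonneg)
    have cF: "continuous_on UNIV (F j)" for j
      unfolding F_def by (intro continuous_intros)
    have [measurable]: "F j \<in> borel_measurable borel" for j
      by (rule borel_measurable_continuous_onI) (rule cF)
    have limF: "(\<lambda>j. F j z) \<longlonglongrightarrow> of_bool (z \<in> K)" for z
    proof (cases "z \<in> K")
      case True
      then show ?thesis by (simp add: F_def)
    next
      case False
      then have pos: "infdist z K > 0" using K
        by (metis in_closed_iff_infdist_zero infdist_nonneg less_eq_real_def)
      obtain j0 :: nat where j0: "1 / infdist z K < j0" using reals_Archimedean2 by blast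
      have "F j z = 0" if "j \<ge> j0" for j
      proof -
        have "1 / infdist z K < j" using j0 that by linarith
        then show ?thesis using pos by (simp add: F_def field_simps)
      qed
      then have "\<forall>\<^sub>F j in sequentially. F j z = of_bool (z \<in> K)"
        using False by (auto simp: eventually_sequentially)
      then show ?thesis by (rule tendsto_eventually)
    qed
    have Kiff: "e2pi t \<in> K \<longleftrightarrow> t \<le> a" if "t \<in> {0..<1}" for t
    proof
      assume "e2pi t \<in> K"
      then obtain s where "s \<in> {0..a}" "e2pi t = e2pi s" by (auto simp: K_def)
      then show "t \<le> a" using inj_onD[OF inj_on_e2pi, of t s] that 2 by auto
    qed (use that 2 in \<open>auto simp: K_def\<close>)
    have lim: "(\<lambda>j. LINT x|L. Q x * of_real (F j (e2pi (Z x)))) \<longlonglongrightarrow> (LINT x|L. Q x * of_bool (Z x \<le> a))"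
      if Q: "integrable L Q" and [measurable]: "Z \<in> borel_measurable L"
        and Z: "\<And>x. x \<in> space L \<Longrightarrow> Z x \<in> {0..<1}" for L :: "'x measure" and Q :: "'x \<Rightarrow> complex" and Z
    proof (rule integral_dominated_convergence[where w="\<lambda>x. cmod (Q x)"])
      show "(\<lambda>x. Q x * of_bool (Z x \<le> a)) \<in> borel_measurable L"
        using Q by measurable
      show "(\<lambda>x. Q x * of_real (F j (e2pi (Z x)))) \<in> borel_measurable L" for j
        using Q by measurable
      show "AE x in L. (\<lambda>j. Q x * of_real (F j (e2pi (Z x)))) \<longlonglongrightarrow> Q x * of_bool (Z x \<le> a)"
      proof (rule AE_I2)
        fix x assume "x \<in> space L"
        then have "of_bool (Z x \<le> a) = complex_of_real (of_bool (e2pi (Z x) \<in> K))"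
          using Kiff[OF Z] by simp
        then show "(\<lambda>j. Q x * of_real (F j (e2pi (Z x)))) \<longlonglongrightarrow> Q x * of_bool (Z x \<le> a)"
          by (simp only:) (intro tendsto_intros limF)
      qed
      show "AE x in L. norm (Q x * of_real (F j (e2pi (Z x)))) \<le> cmod (Q x)" for j
        using F01 by (auto simp: norm_mult abs_of_nonneg intro!: mult_left_le)
    qed (use Q in auto)
    have "(\<lambda>j. LINT x|M. G x * of_real (F j (e2pi (X x)))) \<longlonglongrightarrow> (LINT x|M. G x * of_bool (X x \<le> a))"
      by (rule lim) (use G X in auto)
    moreover have "(\<lambda>j. LINT x|N. H x * of_real (F j (e2pi (Y x)))) \<longlonglongrightarrow> (LINT x|N. H x * of_bool (Y x \<le> a))"
      by (rule lim) (use H Y in auto)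
    moreover have "(LINT x|M. G x * of_real (F j (e2pi (X x)))) = (LINT x|N. H x * of_real (F j (e2pi (Y x))))" for j
      by (rule continuous_fourier[OF cF assms(1,2) G H eq])
    ultimately show ?thesis using LIMSEQ_unique by fastforce
  qed
qed

section \<open>Characters and uniqueness on countable products\<close>

definition torus_char :: "nat \<Rightarrow> (nat \<Rightarrow> int) \<Rightarrow> (nat \<Rightarrow> real) \<Rightarrow> complex" where
  "torus_char d n x = (\<Prod>i<d. e2pi (of_int (n i) * x i))"

lemma set_integral_compl:
  fixes f :: "'a \<Rightarrow> complex"
  assumes "integrable M f" "A \<in> sets M"
  shows "(LINT x:(space M - A)|M. f x) = (LINT x|M. f x) - (LINT x:A|M. f x)"
proof -
  have "(LINT x|M. f x) = (LINT x:(A \<union> (space M - A))|M. f x)"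
    using assms sets.sets_into_space[of A M]
    by (auto simp: set_lebesgue_integral_def intro!: Bochner_Integration.integral_cong)
  also have "\<dots> = (LINT x:A|M. f x) + (LINT x:(space M - A)|M. f x)"
    using assms by (intro set_integral_Un) (auto simp: set_integrable_def intro!: integrable_mult_indicator)
  finally show ?thesis by simp
qed

text \<open>The assumptions are weak enough to treat a discrete two-point factor and the half-open
  unit interval alike.\<close>

context
  fixes K :: "nat \<Rightarrow> real measure"
  assumes K_space: "\<And>i. space (K i) \<subseteq> {0..<1}"
    and K_sets: "\<And>i. sets (K i) \<subseteq> sets borel"
    and K_measurable: "\<And>i. (\<lambda>x. x) \<in> borel_measurable (K i)"
begin

lemma PiM_coordinate_range: "x \<in> space (PiM UNIV K) \<Longrightarrow> x i \<in> {0..<1}"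
  using K_space[of i] by (auto simp: space_PiM PiE_iff)

lemma PiM_coordinate_measurable: "(\<lambda>x. x i) \<in> borel_measurable (PiM UNIV K)"
  using measurable_compose[OF measurable_component_singleton[of i UNIV K] K_measurable[of i]] by simp

text \<open>The coordinates are measurable for the sigma-algebra generated by the boxes, so it
  contains the product sigma-algebra.\<close>

lemma sets_PiM_subset_boxes:
  "sets (PiM UNIV K) \<subseteq> sigma_sets (space (PiM UNIV K))
     {{x \<in> space (PiM UNIV K). \<forall>i<m. x i \<le> a i} |m a. True}"
    (is "_ \<subseteq> sigma_sets ?\<Omega> ?G")
proof -
  have G: "?G \<subseteq> Pow ?\<Omega>" by auto
  have meas: "(\<lambda>x. x i) \<in> borel_measurable (sigma ?\<Omega> ?G)" for i
    unfolding borel_measurable_iff_le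
  proof
    fix a
    \<comment> \<open>A bound on a single coordinate is written as a box; the bound 1 on the earlier
      coordinates is vacuous, as they lie in [0,1).\<close>
    have eq: "{x \<in> space (sigma ?\<Omega> ?G). x i \<le> a} =
      {x \<in> ?\<Omega>. \<forall>j<Suc i. x j \<le> (if j = i then a else 1)}"
      unfolding space_measure_of[OF G]
    proof (intro Collect_cong conj_cong refl)
      fix x assume x: "x \<in> ?\<Omega>"
      have "x j \<le> 1" for j using PiM_coordinate_range[OF x, of j] by simp
      then show "x i \<le> a \<longleftrightarrow> (\<forall>j<Suc i. x j \<le> (if j = i then a else 1))"
        by (auto simp: less_Suc_eq)
    qed
    show "{x \<in> space (sigma ?\<Omega> ?G). x i \<le> a} \<in> sets (sigma ?\<Omega> ?G)"
      unfolding eq sets_measure_of[OF G] by (rule sigma_sets.Basic, rule CollectI, rule exI[of _ "Suc i"],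
          rule exI[of _ "\<lambda>j. if j = i then a else 1"]) simp
  qed
  have "(\<lambda>x. x) \<in> measurable (sigma ?\<Omega> ?G) (PiM UNIV K)"
  proof (rule measurable_PiM_single)
    fix A and i :: nat assume "A \<in> sets (K i)"
    then have "A \<in> sets borel" using K_sets by auto
    from measurable_sets[OF meas this]
    show "{x \<in> space (sigma ?\<Omega> ?G). x i \<in> A} \<in> sets (sigma ?\<Omega> ?G)"
      by (simp only: vimage_def Int_def mem_Collect_eq conj_commute)
  qed (unfold space_measure_of[OF G], simp add: space_PiM)
  note id = this
  show ?thesis
  proof
    fix A assume A: "A \<in> sets (PiM UNIV K)"
    then have "(\<lambda>x. x) -` A \<inter> space (sigma ?\<Omega> ?G) = A"
      using sets.sets_into_space[OF A] unfolding space_measure_of[OF G] by auto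
    with measurable_sets[OF id A] show "A \<in> sigma_sets ?\<Omega> ?G"
      unfolding sets_measure_of[OF G] by simp
  qed
qed

text \<open>The passage from exponentials to indicators is made one coordinate at a time: the first
  \<open>m\<close> coordinates already carry indicators, the next \<open>d\<close> still carry
  exponentials.\<close>

lemma box_fourier:
  assumes [measurable_cong]: "sets M = sets (PiM UNIV K)" "sets N = sets (PiM UNIV K)"
    and G: "integrable M G" and H: "integrable N H"
    and eq: "\<And>d n. (LINT x|M. G x * torus_char d n x) = (LINT x|N. H x * torus_char d n x)"
  shows "(LINT x|M. G x * (of_bool (\<forall>i<m. x i \<le> a i) * (\<Prod>i=m..<m+d. e2pi (of_int (n i) * x i)))) =
     (LINT x|N. H x * (of_bool (\<forall>i<m. x i \<le> a i) * (\<Prod>i=m..<m+d. e2pi (of_int (n i) * x i))))"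
proof (induction m arbitrary: n d)
  case 0
  then show ?case using eq by (simp add: torus_char_def atLeast0LessThan)
next
  case (Suc m)
  note [measurable] = PiM_coordinate_measurable
  have sp: "space M = space (PiM UNIV K)" "space N = space (PiM UNIV K)"
    using sets_eq_imp_space_eq[OF assms(1)] sets_eq_imp_space_eq[OF assms(2)] by simp_all
  define W where "W = (\<lambda>x. of_bool (\<forall>i<m. x i \<le> a i) * (\<Prod>i=Suc m..<Suc m+d. e2pi (of_int (n i) * x i)))"
  have W: "integrable L (\<lambda>x. Q x * W x)" if "integrable L Q"
    and [measurable_cong]: "sets L = sets (PiM UNIV K)" for L Q
  proof (rule Bochner_Integration.integrable_bound[OF that(1)])
    show "(\<lambda>x. Q x * W x) \<in> borel_measurable L"
      using that(1) unfolding W_def by measurable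
    show "AE x in L. cmod (Q x * W x) \<le> cmod (Q x)"
      by (auto simp: W_def norm_mult prod_norm[symmetric])
  qed
  have split: "of_bool (\<forall>i<Suc m. x i \<le> a i) * (\<Prod>i=Suc m..<Suc m+d. e2pi (of_int (n i) * x i)) =
      W x * of_bool (x m \<le> a m)" for x :: "nat \<Rightarrow> real"
    by (auto simp: W_def less_Suc_eq)
  have "(LINT x|M. G x * W x * of_bool (x m \<le> a m)) = (LINT x|N. H x * W x * of_bool (x m \<le> a m))"
  proof (rule interval_fourier)
    fix r :: int
    \<comment> \<open>The induction hypothesis with one more exponential, of free frequency
      \<open>r\<close> at place \<open>m\<close>, supplies all Fourier coefficients in the
      coordinate \<open>x m\<close>.\<close>
    have "(\<Prod>i=m..<m + Suc d. e2pi (of_int ((n(m := r)) i) * x i)) =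
       e2pi (of_int r * x m) * (\<Prod>i=Suc m..<Suc m + d. e2pi (of_int (n i) * x i))" for x :: "nat \<Rightarrow> real"
      by (subst prod.atLeast_Suc_lessThan) (auto intro!: prod.cong)
    then show "(LINT x|M. G x * W x * e2pi (of_int r * x m)) = (LINT x|N. H x * W x * e2pi (of_int r * x m))"
      using Suc[of "n(m := r)" "Suc d"] by (simp add: W_def mult_ac)
  qed (use PiM_coordinate_range W G H assms(1,2) in \<open>auto simp: sp\<close>)
  then show ?case unfolding split by (simp add: mult.assoc)
qed

text \<open>Boxes form an intersection-stable generator on which \<open>box_fourier\<close> gives
  equality; Dynkin's theorem extends it to all measurable sets. Weights and measures may both
  differ, so the lemma serves to identify measures as well as functions.\<close>

lemma fourier_uniqueness:
  assumes M [measurable_cong]: "sets M = sets (PiM UNIV K)" and N [measurable_cong]: "sets N = sets (PiM UNIV K)"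
    and G: "integrable M G" and H: "integrable N H"
    and eq: "\<And>d n. (LINT x|M. G x * torus_char d n x) = (LINT x|N. H x * torus_char d n x)"
    and B: "B \<in> sets (PiM UNIV K)"
  shows "(LINT x:B|M. G x) = (LINT x:B|N. H x)"
proof -
  let ?\<Omega> = "space (PiM UNIV K)"
  let ?G = "{{x \<in> ?\<Omega>. \<forall>i<m. x i \<le> a i} |m a. True}"
  note [measurable] = PiM_coordinate_measurable
  have sp: "space M = ?\<Omega>" "space N = ?\<Omega>"
    using sets_eq_imp_space_eq[OF assms(1)] sets_eq_imp_space_eq[OF assms(2)] by simp_all
  have GK: "?G \<subseteq> sets (PiM UNIV K)"
    by (auto intro!: measurable)
  then have GK': "A \<in> sets (PiM UNIV K)" if "A \<in> sigma_sets ?\<Omega> ?G" for A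
    using that sets.sigma_sets_subset by blast
  have "Int_stable ?G"
  proof (rule Int_stableI, clarify)
    fix m m' :: nat and a a' :: "nat \<Rightarrow> real"
    have "{x \<in> ?\<Omega>. \<forall>i<m. x i \<le> a i} \<inter> {x \<in> ?\<Omega>. \<forall>i<m'. x i \<le> a' i} =
      {x \<in> ?\<Omega>. \<forall>i<max m m'. x i \<le> min (if i < m then a i else 1) (if i < m' then a' i else 1)}"
      using PiM_coordinate_range by (auto simp: less_max_iff_disj less_imp_le)
    then show "\<exists>m'' a''. {x \<in> ?\<Omega>. \<forall>i<m. x i \<le> a i} \<inter> {x \<in> ?\<Omega>. \<forall>i<m'. x i \<le> a' i} =
        {x \<in> ?\<Omega>. \<forall>i<m''. x i \<le> a'' i} \<and> True"
      by (intro exI conjI TrueI)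
  qed
  moreover have "?G \<subseteq> Pow ?\<Omega>" by auto
  moreover have "B \<in> sigma_sets ?\<Omega> ?G" using B sets_PiM_subset_boxes by auto
  ultimately show ?thesis
  proof (induction rule: sigma_sets_induct_disjoint)
    case (basic A)
    then obtain m a where A: "A = {x \<in> ?\<Omega>. \<forall>i<m. x i \<le> a i}" by blast
    have "(LINT x:A|L. Q x) = (LINT x|L. Q x * of_bool (\<forall>i<m. x i \<le> a i))"
      if "space L = ?\<Omega>" for L and Q :: "_ \<Rightarrow> complex"
      unfolding set_lebesgue_integral_def
      by (rule Bochner_Integration.integral_cong) (auto simp: A that indicator_def)
    with sp show ?case using box_fourier[OF M N G H eq, where d=0 and m=m and a=a] by simp
  next
    case empty
    then show ?case by (simp add: set_lebesgue_integral_def)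
  next
    case (compl A)
    have "(LINT x|M. G x) = (LINT x|N. H x)" using eq[of 0] by (simp add: torus_char_def)
    then show ?case
      using compl set_integral_compl[OF G, of A] set_integral_compl[OF H, of A] GK' M N by (simp add: sp)
  next
    case (union A)
    have A: "A i \<in> sets (PiM UNIV K)" for i using union(2) GK' by blast
    have "(LINT x:(\<Union>i. A i)|L. Q x) = (\<Sum>i. LINT x:A i|L. Q x)"
      if "integrable L Q" "sets L = sets (PiM UNIV K)" for L and Q :: "_ \<Rightarrow> complex"
      using that A union(1)
      by (intro lebesgue_integral_countable_add)
        (auto simp: disjoint_family_on_def set_integrable_def intro!: integrable_mult_indicator)
    then show ?case using G H M N union(3) by simp
  qed
qed

end

section \<open>Polynomial phases and van der Corput\<close>

lemma borel_measurable_cnj [measurable]: "cnj \<in> borel_measurable borel"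
  by (intro borel_measurable_continuous_onI continuous_intros)

section \<open>Measure preserving maps and calculus of phases\<close>

lemma mps_measurable: "mps M S \<Longrightarrow> S \<in> measurable M M"
  by (simp add: mps_def)

lemma mps_AE: "mps M S \<Longrightarrow> AE x in M. P x \<Longrightarrow> AE x in M. P (S x)"
  unfolding mps_def by (metis AE_distrD)

lemma mps_integral:
  fixes f :: "'a \<Rightarrow> complex"
  assumes "mps M S" "f \<in> borel_measurable M"
  shows "(LINT x|M. f (S x)) = (LINT x|M. f x)"
  using integral_distr[of S M M f] assms by (simp add: mps_def)

lemma mps_funpow: "mps M S \<Longrightarrow> mps M (S ^^ n)"
proof (induction n)
  case 0
  then show ?case by (simp add: mps_def id_def distr_id)
next
  case (Suc n)
  then show ?case
    using distr_distr[of S M M "S ^^ n" M] measurable_comp[of "S ^^ n" M M S M] by (simp add: mps_def o_def)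
qed

fun poly_phase :: "'a measure \<Rightarrow> ('a \<Rightarrow> 'a) \<Rightarrow> nat \<Rightarrow> complex \<Rightarrow> ('a \<Rightarrow> complex) \<Rightarrow> bool" where
  "poly_phase M S 0 c f \<longleftrightarrow> f \<in> borel_measurable M \<and> (AE x in M. f x = c)"
| "poly_phase M S (Suc k) c f \<longleftrightarrow> f \<in> borel_measurable M \<and> (AE x in M. cmod (f x) = 1) \<and>
     poly_phase M S k c (\<lambda>x. f (S x) * cnj (f x))"

lemma E_iff_poly_phase: "f \<in> E M k S \<longleftrightarrow> (\<exists>c. eigenvalue M S c \<and> poly_phase M S k c f)"
  by (induction k arbitrary: f) auto

lemma poly_phase_measurable: "poly_phase M S k c f \<Longrightarrow> f \<in> borel_measurable M"
  by (cases k) auto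

lemma poly_phase_norm: "poly_phase M S (Suc k) c f \<Longrightarrow> AE x in M. cmod (f x) = 1"
  by simp

lemma poly_phase_cong_AE:
  assumes S: "mps M S" and "poly_phase M S k c f" "AE x in M. f x = g x" "g \<in> borel_measurable M"
  shows "poly_phase M S k c g"
  using assms(2-4)
proof (induction k arbitrary: f g)
  case 0
  then show ?case by auto
next
  case (Suc k)
  note [measurable] = mps_measurable[OF S] Suc.prems(3)
  have "poly_phase M S k c (\<lambda>x. f (S x) * cnj (f x))"
    using Suc.prems(1) by simp
  moreover have "AE x in M. f (S x) * cnj (f x) = g (S x) * cnj (g x)"
    using Suc.prems(2) mps_AE[OF S Suc.prems(2)] by eventually_elim simp
  moreover have "(\<lambda>x. g (S x) * cnj (g x)) \<in> borel_measurable M"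
    by measurable
  ultimately have "poly_phase M S k c (\<lambda>x. g (S x) * cnj (g x))"
    by (rule Suc.IH)
  moreover have "AE x in M. cmod (g x) = 1"
    using Suc.prems(2) poly_phase_norm[OF Suc.prems(1)] by eventually_elim simp
  ultimately show ?case using Suc.prems(3) by simp
qed

lemma poly_phase_mult:
  assumes "poly_phase M S k c f" "poly_phase M S k d g"
  shows "poly_phase M S k (c * d) (\<lambda>x. f x * g x)"
  using assms
proof (induction k arbitrary: f g)
  case (Suc k)
  have "poly_phase M S k (c * d) (\<lambda>x. (f (S x) * cnj (f x)) * (g (S x) * cnj (g x)))"
    using Suc by simp
  then have "poly_phase M S k (c * d) (\<lambda>x. f (S x) * g (S x) * cnj (f x * g x))"
    by (simp add: mult_ac)
  with Suc.prems show ?case by (auto simp: norm_mult)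
qed auto

lemma poly_phase_cnj:
  assumes "poly_phase M S k c f"
  shows "poly_phase M S k (cnj c) (\<lambda>x. cnj (f x))"
  using assms
proof (induction k arbitrary: f)
  case (Suc k)
  have "poly_phase M S k (cnj c) (\<lambda>x. cnj (f (S x) * cnj (f x)))"
    using Suc by (simp del: complex_cnj_mult)
  moreover have "(\<lambda>x. cnj (f x)) \<in> borel_measurable M"
    using poly_phase_measurable[OF Suc.prems] by measurable
  ultimately show ?case using Suc.prems by simp
qed auto

lemma poly_phase_comp:
  assumes S: "mps M S" and "poly_phase M S k c f"
  shows "poly_phase M S k c (\<lambda>x. f (S x))"
  using assms(2)
proof (induction k arbitrary: f)
  case 0
  note [measurable] = mps_measurable[OF S]
  from 0 show ?case using mps_AE[OF S, of "\<lambda>x. f x = c"] by auto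
next
  case (Suc k)
  note [measurable] = mps_measurable[OF S]
  from Suc show ?case using mps_AE[OF S, of "\<lambda>x. cmod (f x) = 1"] by auto
qed

lemma poly_phase_comp_funpow:
  assumes "mps M S" and "poly_phase M S k c f"
  shows "poly_phase M S k c (\<lambda>x. f ((S ^^ n) x))"
proof (induction n)
  case (Suc n)
  from poly_phase_comp[OF assms(1) this] show ?case by (simp add: funpow_swap1)
qed (use assms in simp)

lemma poly_phase_one: "poly_phase M S k 1 (\<lambda>_. 1)"
  by (induction k) auto

lemma poly_phase_const: "cmod c = 1 \<Longrightarrow> poly_phase M S (Suc k) 1 (\<lambda>_. c)"
  using poly_phase_one[of M S k] by (simp add: complex_norm_square[symmetric])

text \<open>The first difference of a unimodular eigenfunction is constant, and all later
  differences are 1. Hence an eigenfunction can multiply a phase of degree at least two without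
  changing the final constant.\<close>

lemma poly_phase_eigen:
  assumes S: "mps M S" and u: "poly_phase M S 1 c u" and c: "cmod c = 1"
  shows "poly_phase M S (Suc (Suc k)) 1 u"
proof -
  note [measurable] = mps_measurable[OF S]
  have [measurable]: "u \<in> borel_measurable M" using u by simp
  have "poly_phase M S (Suc k) 1 (\<lambda>x. u (S x) * cnj (u x))"
    by (rule poly_phase_cong_AE[OF S poly_phase_const[OF c]]) (use u in auto)
  then show ?thesis using u by simp
qed

lemma mult_cnj_eq_1: "cmod z = 1 \<Longrightarrow> z * cnj z = 1" "cmod z = 1 \<Longrightarrow> cnj z * z = 1"
  by (simp_all add: complex_norm_square[symmetric] mult.commute)

text \<open>The difference along \<open>S ^^ n\<close> telescopes into a product of \<open>n\<close>
  shifted first differences, each with constant \<open>c\<close>.\<close>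

lemma poly_phase_diff_funpow:
  assumes S: "mps M S" and w: "poly_phase M S (Suc k) c w"
  shows "poly_phase M S k (c ^ n) (\<lambda>x. w ((S ^^ n) x) * cnj (w x))"
proof (induction n)
  case 0
  have "AE x in M. 1 = w x * cnj (w x)"
    using poly_phase_norm[OF w] by eventually_elim (simp add: mult_cnj_eq_1)
  moreover have "(\<lambda>x. w x * cnj (w x)) \<in> borel_measurable M"
    using poly_phase_measurable[OF w] by measurable
  ultimately show ?case using poly_phase_cong_AE[OF S poly_phase_one] by simp
next
  case (Suc n)
  note [measurable] = mps_measurable[OF S] mps_measurable[OF mps_funpow[OF S]] poly_phase_measurable[OF w]
  have "poly_phase M S k (c * c ^ n)
      (\<lambda>x. (w (S ((S ^^ n) x)) * cnj (w ((S ^^ n) x))) * (w ((S ^^ n) x) * cnj (w x)))"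
    using w by (intro poly_phase_mult Suc poly_phase_comp_funpow[OF S, of k c "\<lambda>x. w (S x) * cnj (w x)"]) auto
  moreover have "AE x in M. (w (S ((S ^^ n) x)) * cnj (w ((S ^^ n) x))) * (w ((S ^^ n) x) * cnj (w x)) =
      w ((S ^^ Suc n) x) * cnj (w x)"
    using mps_AE[OF mps_funpow[OF S] poly_phase_norm[OF w], of n]
  proof eventually_elim
    case (elim x)
    have "(w (S ((S ^^ n) x)) * cnj (w ((S ^^ n) x))) * (w ((S ^^ n) x) * cnj (w x)) =
      (cnj (w ((S ^^ n) x)) * w ((S ^^ n) x)) * (w ((S ^^ Suc n) x) * cnj (w x))" by simp
    also have "\<dots> = w ((S ^^ Suc n) x) * cnj (w x)" by (subst mult_cnj_eq_1(2)[OF elim]) simp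
    finally show ?case .
  qed
  ultimately show ?case
    unfolding power_Suc by (rule poly_phase_cong_AE[OF S]) measurable
qed

text \<open>Each of the \<open>k\<close> differences is taken along two steps instead of one, which
  squares the constant each time.\<close>

lemma poly_phase_square:
  assumes T: "mps M T" and "poly_phase M T k c f"
  shows "poly_phase M (T ^^ 2) k (c ^ 2 ^ k) f"
  using assms(2)
proof (induction k arbitrary: c f)
  case (Suc k)
  note [measurable] = mps_measurable[OF mps_funpow[OF T]] poly_phase_measurable[OF Suc.prems]
  have "poly_phase M (T ^^ 2) k ((c ^ 2) ^ 2 ^ k) (\<lambda>x. f ((T ^^ 2) x) * cnj (f x))"
    by (intro Suc.IH poly_phase_diff_funpow[OF T Suc.prems])
  then show ?case using Suc.prems by (simp add: power_mult)
qed simp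

text \<open>The function is multiplied by \<open>c\<close> under \<open>S\<close> while its integral
  is unchanged.\<close>

lemma integral_poly_phase_1:
  assumes S: "mps M S" and w: "poly_phase M S 1 c w" and c: "c \<noteq> 1"
  shows "(LINT x|M. w x) = 0"
proof -
  note [measurable] = mps_measurable[OF S]
  have [measurable]: "w \<in> borel_measurable M" using w by simp
  have "AE x in M. cmod (w x) = 1" "AE x in M. w (S x) * cnj (w x) = c" using w by auto
  then have "AE x in M. w (S x) = c * w x"
  proof eventually_elim
    case (elim x)
    then show ?case using mult_cnj_eq_1(2)[OF elim(1)] by (metis mult.assoc mult.right_neutral)
  qed
  then have "(LINT x|M. w (S x)) = (LINT x|M. c * w x)"
    by (intro integral_cong_AE) measurable
  then have "(LINT x|M. w x) = c * (LINT x|M. w x)"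
    by (simp add: mps_integral[OF S])
  with c show ?thesis by simp
qed

text \<open>Van der Corput's argument: by induction the functions \<^term>\<open>w \<circ> S ^^ n\<close> are orthonormal, so their
  averages tend to 0 in mean square, while all of them have the same integral.\<close>

lemma integral_poly_phase_eq_0:
  assumes S: "mps M S" and w: "poly_phase M S (Suc k) c w" and c: "\<And>n. n > 0 \<Longrightarrow> c ^ n \<noteq> 1"
  shows "(LINT x|M. w x) = 0"
  using w c
proof (induction k arbitrary: c w)
  case 0
  then show ?case using integral_poly_phase_1[OF S, of c w] 0(2)[of 1] by simp
next
  case (Suc k)
  interpret prob_space M using S by (simp add: mps_def)
  note SN = mps_funpow[OF S]
  note [measurable] = mps_measurable[OF S] mps_measurable[OF SN] poly_phase_measurable[OF Suc.prems(1)]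
  define W where "W n x = w ((S ^^ n) x)" for n x
  have [measurable]: "W n \<in> borel_measurable M" for n unfolding W_def by measurable
  have W1: "AE x in M. cmod (W n x) = 1" for n
    unfolding W_def by (rule mps_AE[OF SN poly_phase_norm[OF Suc.prems(1)]])
  have int: "integrable M (W n)" for n
    by (rule integrable_const_bound[where B=1]) (use W1[of n] in auto)
  have int2: "integrable M (\<lambda>x. W i x * cnj (W j x))" for i j
  proof (rule integrable_const_bound[where B=1])
    show "AE x in M. cmod (W i x * cnj (W j x)) \<le> 1"
      using W1[of i] W1[of j] by eventually_elim (simp add: norm_mult)
  qed measurable
  have less: "(LINT x|M. W i x * cnj (W j x)) = 0" if "j < i" for i j
  proof -
    \<comment> \<open>Up to the shift by \<open>j\<close>, this is the difference of
      \<open>w\<close> along \<open>i - j\<close> steps: a phase of one degree less whose constant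
      is a positive power of \<open>c\<close>, hence again not a root of unity.\<close>
    have "W i x * cnj (W j x) = (\<lambda>y. w ((S ^^ (i - j)) y) * cnj (w y)) ((S ^^ j) x)" for x
      using that by (simp add: W_def funpow_add[symmetric, THEN fun_cong, unfolded o_def])
    then have "(LINT x|M. W i x * cnj (W j x)) = (LINT y|M. w ((S ^^ (i - j)) y) * cnj (w y))"
      by (simp only:) (rule mps_integral[OF SN], measurable)
    also have "\<dots> = 0"
    proof (rule Suc.IH[OF poly_phase_diff_funpow[OF S Suc.prems(1)]])
      fix n :: nat assume "n > 0"
      then show "(c ^ (i - j)) ^ n \<noteq> 1"
        using Suc.prems(2)[of "(i - j) * n"] that by (simp add: power_mult)
    qed
    finally show ?thesis .
  qed
  have orth: "(LINT x|M. W i x * cnj (W j x)) = of_bool (i = j)" for i j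
  proof (cases i j rule: linorder_cases)
    case less
    have "(LINT x|M. W i x * cnj (W j x)) = (LINT x|M. cnj (W j x * cnj (W i x)))"
      by (simp add: mult.commute)
    also have "\<dots> = cnj (LINT x|M. W j x * cnj (W i x))" by (rule Bochner_Integration.integral_cnj)
    also have "\<dots> = 0" using \<open>\<And>j i. j < i \<Longrightarrow> _ = 0\<close>[OF less] by simp
    finally show ?thesis using less by simp
  next
    case equal
    have "(LINT x|M. W i x * cnj (W i x)) = (LINT x|M. 1)"
    proof (rule integral_cong_AE)
      show "AE x in M. W i x * cnj (W i x) = 1"
        using W1[of i] by eventually_elim (rule mult_cnj_eq_1)
    qed measurable
    then show ?thesis using equal by (simp add: prob_space)
  qed (use less in simp)
  define z where "z = (LINT x|M. w x)"
  have z: "(LINT x|M. W n x) = z" for n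
    unfolding W_def z_def by (rule mps_integral[OF SN]) measurable
  \<comment> \<open>By orthonormality the mean square of \<open>A - N * z\<close> is
    \<open>N - N * N * (cmod z)\<^sup>2\<close>, which cannot be negative.\<close>
  have bound: "real N * (cmod z)\<^sup>2 \<le> 1" if "N > 0" for N
  proof -
    define A where "A x = (\<Sum>n<N. W n x)" for x
    have A: "integrable M A" unfolding A_def using int by auto
    have Az: "(LINT x|M. A x) = N * z" by (simp add: A_def int z)
    have A2: "A x * cnj (A x) = (\<Sum>i<N. \<Sum>j<N. W i x * cnj (W j x))" for x
      by (simp add: A_def sum_product)
    have iA2: "integrable M (\<lambda>x. A x * cnj (A x))"
      unfolding A2 using int2 by auto
    have "(LINT x|M. A x * cnj (A x)) = N"
      unfolding A2 by (simp add: int2 orth)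
    moreover have "(A x - N * z) * cnj (A x - N * z) =
       A x * cnj (A x) - N * cnj z * A x - N * z * cnj (A x) + N * N * (z * cnj z)" for x
      by (simp add: algebra_simps)
    ultimately have "(LINT x|M. (A x - N * z) * cnj (A x - N * z)) =
        N - N * cnj z * (N * z) - N * z * cnj (N * z) + N * N * (z * cnj z)"
      using A iA2 by (simp add: Az prob_space)
    also have "\<dots> = complex_of_real (N - N * N * (cmod z)\<^sup>2)"
      using complex_norm_square[of z] by (simp add: algebra_simps)
    finally have "complex_of_real (N - N * N * (cmod z)\<^sup>2) = (LINT x|M. complex_of_real ((cmod (A x - N * z))\<^sup>2))"
      by (simp only: complex_norm_square)
    then have "N - N * N * (cmod z)\<^sup>2 = (LINT x|M. (cmod (A x - N * z))\<^sup>2)"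
      by (metis integral_complex_of_real of_real_eq_iff)
    then have "0 \<le> N - N * N * (cmod z)\<^sup>2" by simp
    then have "N * (N * (cmod z)\<^sup>2) \<le> N * 1" by (simp add: mult.assoc)
    then show ?thesis using that by simp
  qed
  have "cmod z = 0"
  proof (rule ccontr)
    assume "cmod z \<noteq> 0"
    then have pos: "(cmod z)\<^sup>2 > 0" by simp
    obtain N :: nat where N: "1 / (cmod z)\<^sup>2 < N" using reals_Archimedean2 by blast
    then have "1 < N * (cmod z)\<^sup>2" using pos by (simp add: field_simps)
    then have "N > 0" by (cases N) auto
    with \<open>1 < N * (cmod z)\<^sup>2\<close> show False using bound[of N] by simp
  qed
  then show ?case by (simp add: z_def)
qed

section \<open>The tower over the skew product\<close>

text \<open>The floor of the tower is encoded by \<open>x 0 \<in> {0, 1/2}\<close>, so that \<^term>\<open>e2pi (x 0)\<close> is the nontrivial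
  character of the group of order two and all coordinates can be treated alike.\<close>

definition coord :: "nat \<Rightarrow> real measure" where
  "coord i = (if i = 0 then uniform_count_measure {0, 1/2} else restrict_space lborel {0..<1})"

definition tower_space :: "(nat \<Rightarrow> real) measure" where
  "tower_space = PiM UNIV coord"

text \<open>The floor is carried along unchanged, so that this map of the whole space is the square
  of the tower map. Since place 0 is taken by the floor, \<alpha> stands in for the coordinate
  before the first.\<close>

definition skew :: "real \<Rightarrow> (nat \<Rightarrow> real) \<Rightarrow> nat \<Rightarrow> real" where
  "skew \<alpha> x i = (if i = 0 then x 0 else frac (x i + (if i = 1 then \<alpha> else x (i - 1))))"

definition tower :: "real \<Rightarrow> (nat \<Rightarrow> real) \<Rightarrow> nat \<Rightarrow> real" where
  "tower \<alpha> x = (if x 0 = 0 then x(0 := 1/2) else (skew \<alpha> x)(0 := 0))"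

lemma space_coord: "space (coord i) = (if i = 0 then {0, 1/2} else {0..<1})"
  by (simp add: coord_def space_restrict_space space_uniform_count_measure)

lemma space_coord_subset: "space (coord i) \<subseteq> {0..<1}"
  by (auto simp: space_coord)

lemma sets_coord_subset: "sets (coord i) \<subseteq> sets borel"
proof (cases "i = 0")
  case True
  have "A \<in> sets borel" if "A \<subseteq> {0, 1/2}" for A :: "real set"
    using finite_subset[OF that] by (intro borel_closed finite_imp_closed) auto
  then show ?thesis using True by (auto simp: coord_def sets_uniform_count_measure)
next
  case False
  then show ?thesis by (auto simp: coord_def sets_restrict_space)
qed

lemma measurable_coord: "(\<lambda>x. x) \<in> borel_measurable (coord i)"
proof (cases "i = 0")
  case True
  then show ?thesis
    by (intro measurableI) (auto simp: coord_def sets_uniform_count_measure space_uniform_count_measure)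
next
  case False
  then show ?thesis by (auto simp: coord_def intro!: measurable_restrict_space1)
qed

lemma prob_space_coord: "prob_space (coord i)"
proof (cases "i = 0")
  case True
  then show ?thesis by (auto simp: coord_def intro!: prob_space_uniform_count_measure)
next
  case False
  then show ?thesis
    by (auto simp: coord_def emeasure_restrict_space space_restrict_space intro!: prob_spaceI)
qed

interpretation coord: product_prob_space coord UNIV
  by (intro product_prob_spaceI prob_space_coord)

interpretation tower_space: prob_space tower_space
  unfolding tower_space_def by unfold_locales

lemmas tower_coordinate_measurable =
  PiM_coordinate_measurable[of coord, OF space_coord_subset sets_coord_subset measurable_coord,
    folded tower_space_def]

lemmas tower_fourier_uniqueness =
  fourier_uniqueness[of coord, OF space_coord_subset sets_coord_subset measurable_coord,
    folded tower_space_def]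

lemma space_tower_space: "x \<in> space tower_space \<longleftrightarrow> x 0 \<in> {0, 1/2} \<and> (\<forall>i>0. x i \<in> {0..<1})"
  by (auto simp: tower_space_def space_PiM PiE_iff space_coord split: if_splits)

text \<open>Every measurable set of a factor is Borel, so Borel measurability of the coordinates
  suffices.\<close>

lemma measurable_tower_spaceI:
  assumes "\<And>i. (\<lambda>x. f x i) \<in> borel_measurable N" "\<And>x. x \<in> space N \<Longrightarrow> f x \<in> space tower_space"
  shows "f \<in> measurable N tower_space"
  unfolding tower_space_def
proof (rule measurable_PiM_single)
  show "f \<in> space N \<rightarrow> (\<Pi>\<^sub>E i\<in>UNIV. space (coord i))"
    using assms(2) by (auto simp: tower_space_def space_PiM)
next
  fix A i assume "A \<in> sets (coord i)"
  then have "A \<in> sets borel" using sets_coord_subset by auto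
  from measurable_sets[OF assms(1) this, of i] show "{x \<in> space N. f x i \<in> A} \<in> sets N"
    by (simp add: vimage_def Int_def conj_commute)
qed

lemma skew_in_space: "x \<in> space tower_space \<Longrightarrow> skew \<alpha> x \<in> space tower_space"
  by (auto simp: space_tower_space skew_def frac_lt_1)

lemma tower_in_space: "x \<in> space tower_space \<Longrightarrow> tower \<alpha> x \<in> space tower_space"
  using skew_in_space[of x \<alpha>] by (auto simp: space_tower_space tower_def)

lemma tower_tower: "x \<in> space tower_space \<Longrightarrow> tower \<alpha> (tower \<alpha> x) = skew \<alpha> x"
  by (auto simp: space_tower_space tower_def skew_def fun_eq_iff)

lemma borel_measurable_frac [measurable]: "(frac :: real \<Rightarrow> real) \<in> borel_measurable borel"
  using borel_measurable_real_floor unfolding frac_def[abs_def] by measurable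

lemma measurable_tower [measurable]: "tower \<alpha> \<in> measurable tower_space tower_space"
proof (rule measurable_tower_spaceI)
  fix i
  note [measurable] = tower_coordinate_measurable
  show "(\<lambda>x. tower \<alpha> x i) \<in> borel_measurable tower_space"
  proof (cases "i = 0")
    case True
    then have "(\<lambda>x. tower \<alpha> x i) = (\<lambda>x. if x 0 = 0 then 1/2 else 0)"
      by (auto simp: tower_def)
    then show ?thesis by simp
  next
    case False
    then have "(\<lambda>x. tower \<alpha> x i) = (\<lambda>x. if x 0 = 0 then x i else skew \<alpha> x i)"
      by (auto simp: tower_def)
    moreover have [measurable]: "(\<lambda>x. skew \<alpha> x i) \<in> borel_measurable tower_space"
      using False by (cases "i = 1") (simp_all add: skew_def)
    ultimately show ?thesis by simp
  qed
qed (rule tower_in_space)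

section \<open>Integrals of characters and invariance of the measure\<close>

lemma measurable_torus_char [measurable]: "torus_char d n \<in> borel_measurable tower_space"
  using tower_coordinate_measurable unfolding torus_char_def by measurable

lemma norm_torus_char [simp]: "cmod (torus_char d n x) = 1"
  by (simp add: torus_char_def prod_norm[symmetric])

lemma integrable_torus_char [simp]: "integrable tower_space (torus_char d n)"
  by (rule tower_space.integrable_const_bound[where B=1]) auto

lemma integral_e2pi_unit_interval:
  "(LINT t|restrict_space lborel {0..<1}. e2pi (of_int n * t)) = of_bool (n = 0)"
proof -
  have "(LINT t|restrict_space lborel {0..<1::real}. e2pi (of_int n * t)) =
      (LINT t|lborel. indicator {0..<1} t *\<^sub>R e2pi (of_int n * t))"
    by (rule integral_restrict_space) auto
  \<comment> \<open>The endpoint 1, a null set, is added so that the fundamental theorem of calculus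
    can be used on a closed interval.\<close>
  also have "\<dots> = (LINT t|lborel. indicator {0..1} t *\<^sub>R e2pi (of_int n * t))"
  proof (rule integral_cong_AE)
    show "AE t in lborel. indicator {0..<1} t *\<^sub>R e2pi (of_int n * t) = indicator {0..1} t *\<^sub>R e2pi (of_int n * t)"
      using AE_lborel_singleton[of 1] by eventually_elim (auto simp: indicator_def)
  qed measurable
  also have "\<dots> = of_bool (n = 0)"
  proof (cases "n = 0")
    case False
    define F where "F = (\<lambda>t. e2pi (of_int n * t) / (2 * pi * n * \<i>))"
    have der: "(F has_vector_derivative e2pi (of_int n * t)) (at t within {0..1})" for t
    proof -
      let ?c = "2 * pi * n * \<i>"
      have "((\<lambda>z. exp (?c * z) / ?c) has_field_derivative exp (?c * of_real t)) (at (of_real t))"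
        using False by (auto intro!: derivative_eq_intros)
      from has_vector_derivative_real_field[OF this] show ?thesis
        by (simp add: F_def e2pi_def cis_conv_exp mult_ac)
    qed
    have "has_bochner_integral lborel (\<lambda>t. indicator {0..1} t *\<^sub>R e2pi (of_int n * t)) (F 1 - F 0)"
      by (rule has_bochner_integral_FTC_Icc) (use der in \<open>auto intro!: continuous_intros\<close>)
    moreover have "F 1 - F 0 = 0" by (simp add: F_def)
    ultimately show ?thesis using False by (simp add: has_bochner_integral_iff)
  qed simp
  finally show ?thesis .
qed

text \<open>The integral factors over the coordinates. The floor contributes the mean over its two
  points, every other coordinate 1 or 0.\<close>

lemma integral_torus_char:
  "(LINT x|tower_space. torus_char (Suc d) n x) =
     (if \<forall>i\<in>{1..d}. n i = 0 then (1 + e2pi (of_int (n 0) / 2)) / 2 else 0)"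
proof -
  have int: "integrable (coord i) (\<lambda>t. e2pi (of_int (n i) * t))" for i
  proof -
    note [measurable] = measurable_coord[of i]
    show ?thesis
      by (rule finite_measure.integrable_const_bound[where B=1])
        (use prob_space_coord in \<open>auto simp: prob_space_def\<close>)
  qed
  have int0: "(LINT t|coord 0. e2pi (of_int (n 0) * t)) = (1 + e2pi (of_int (n 0) / 2)) / 2"
    by (simp only: coord_def simp_thms if_True uniform_count_measure_def, subst lebesgue_integral_point_measure_finite)
      (simp_all add: scaleR_conv_of_real field_simps)
  have intS: "(LINT t|coord i. e2pi (of_int (n i) * t)) = of_bool (n i = 0)" if "i > 0" for i
    using that integral_e2pi_unit_interval by (simp add: coord_def)
  let ?h = "\<lambda>y. \<Prod>i<Suc d. e2pi (of_int (n i) * y i)"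
  have [measurable]: "(\<lambda>y. y i) \<in> borel_measurable (PiM {..<Suc d} coord)" if "i < Suc d" for i
    using measurable_compose[OF measurable_component_singleton[of i "{..<Suc d}" coord] measurable_coord[of i]] that
    by simp
  have "(LINT x|tower_space. torus_char (Suc d) n x) = (LINT x|tower_space. ?h (restrict x {..<Suc d}))"
    by (simp add: torus_char_def)
  also have "\<dots> = (LINT y|distr tower_space (PiM {..<Suc d} coord) (\<lambda>x. restrict x {..<Suc d}). ?h y)"
    unfolding tower_space_def by (rule integral_distr[symmetric], rule measurable_restrict_subset) auto
  also have "\<dots> = (LINT y|PiM {..<Suc d} coord. ?h y)"
    unfolding tower_space_def by (subst coord.distr_PiM_restrict_finite) auto
  also have "\<dots> = (\<Prod>i<Suc d. LINT t|coord i. e2pi (of_int (n i) * t))"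
    by (rule coord.product_integral_prod) (use int in auto)
  also have "\<dots> = (LINT t|coord 0. e2pi (of_int (n 0) * t)) * (\<Prod>i\<in>{1..d}. LINT t|coord i. e2pi (of_int (n i) * t))"
    by (simp add: lessThan_Suc_atMost atMost_atLeast0 prod.atLeast_Suc_atMost)
  also have "(\<Prod>i\<in>{1..d}. LINT t|coord i. e2pi (of_int (n i) * t)) = (\<Prod>i\<in>{1..d}. of_bool (n i = 0))"
    by (intro prod.cong refl intS) auto
  also have "\<dots> = of_bool (\<forall>i\<in>{1..d}. n i = 0)"
    by (auto simp: prod_zero_iff)
  finally show ?thesis unfolding int0 of_bool_def
    by (simp only: mult_1_right mult_zero_right split: if_splits) blast+
qed

lemma torus_char_extend: "n d = 0 \<Longrightarrow> torus_char (Suc d) n = torus_char d n"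
  by (auto simp: torus_char_def fun_eq_iff)

text \<open>Padding with zero exponents makes the coordinates 0 and 1 always present and lets
  exponents be shifted by one place without boundary terms.\<close>

lemma torus_char_normal_form:
  obtains n' where "torus_char d n = torus_char (Suc (Suc d)) n'" "\<And>i. i > d \<Longrightarrow> n' i = 0"
proof
  let ?n = "\<lambda>i. if i < d then n i else 0"
  have "torus_char d n = torus_char d ?n"
    by (auto simp: torus_char_def fun_eq_iff intro!: prod.cong)
  also have "\<dots> = torus_char (Suc (Suc d)) ?n"
    by (simp add: torus_char_extend)
  finally show "torus_char d n = torus_char (Suc (Suc d)) ?n" .
qed auto

lemma torus_char_split:
  "torus_char (Suc d) n x = e2pi (of_int (n 0) * x 0) * (\<Prod>i\<in>{1..d}. e2pi (of_int (n i) * x i))"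
  by (simp add: torus_char_def lessThan_Suc_atMost atMost_atLeast0 prod.atLeast_Suc_atMost)

text \<open>The skew product acts on exponents by the transposed unipotent map. The hypothesis
  removes the boundary term of the index shift.\<close>

lemma prod_e2pi_skew:
  assumes "n (Suc d) = 0"
  shows "(\<Prod>i\<in>{1..d}. e2pi (of_int (n i) * skew \<alpha> x i)) =
    e2pi (of_int (n 1) * \<alpha>) * (\<Prod>i\<in>{1..d}. e2pi (of_int (n i + n (Suc i)) * x i))"
proof -
  define y where "y i = (if i = 0 then \<alpha> else x i)" for i
  have shift: "(\<Prod>i\<in>{1..d}. e2pi (of_int (n i) * y (i - 1))) * e2pi (of_int (n (Suc d)) * y d) =
      e2pi (of_int (n 1) * y 0) * (\<Prod>i\<in>{1..d}. e2pi (of_int (n (Suc i)) * y i))" for d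
    by (induction d) (auto simp: mult_ac)
  have "(\<Prod>i\<in>{1..d}. e2pi (of_int (n i) * skew \<alpha> x i)) =
     (\<Prod>i\<in>{1..d}. e2pi (of_int (n i) * x i) * e2pi (of_int (n i) * y (i - 1)))"
    by (rule prod.cong) (auto simp: skew_def y_def e2pi_int_mult_frac ring_distribs e2pi_add)
  also have "\<dots> = (\<Prod>i\<in>{1..d}. e2pi (of_int (n i) * x i)) *
      (e2pi (of_int (n 1) * y 0) * (\<Prod>i\<in>{1..d}. e2pi (of_int (n (Suc i)) * y i)))"
    using shift[of d] assms by (simp add: prod.distrib)
  also have "\<dots> = e2pi (of_int (n 1) * \<alpha>) * (\<Prod>i\<in>{1..d}. e2pi (of_int (n i) * x i) * e2pi (of_int (n (Suc i)) * y i))"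
    by (simp add: prod.distrib y_def)
  also have "(\<Prod>i\<in>{1..d}. e2pi (of_int (n i) * x i) * e2pi (of_int (n (Suc i)) * y i)) =
     (\<Prod>i\<in>{1..d}. e2pi (of_int (n i + n (Suc i)) * x i))"
    by (rule prod.cong) (auto simp: y_def ring_distribs e2pi_add)
  finally show ?thesis .
qed

lemma e2pi_half [simp]: "e2pi (1/2) = -1"
  by (simp add: e2pi_def)

text \<open>Half of 1 plus or minus the floor character is the indicator of the lower or upper
  floor. This turns the case distinction in \<open>tower\<close> into a linear combination of
  characters, whose integrals are known.\<close>

lemma torus_char_tower:
  assumes x: "x \<in> space tower_space" and n: "n (Suc d) = 0"
  defines "n' \<equiv> (\<lambda>i. n i + n (Suc i))"
  shows "torus_char (Suc d) n (tower \<alpha> x) =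
    e2pi (of_int (n 0) / 2) / 2 * (torus_char (Suc d) (n(0 := 0)) x + torus_char (Suc d) (n(0 := 1)) x) +
    e2pi (of_int (n 1) * \<alpha>) / 2 * (torus_char (Suc d) (n'(0 := 0)) x - torus_char (Suc d) (n'(0 := 1)) x)"
proof -
  have upd: "(\<Prod>i\<in>{1..d}. e2pi (of_int ((m(0 := r)) i) * x i)) = (\<Prod>i\<in>{1..d}. e2pi (of_int (m i) * x i))"
    for m :: "nat \<Rightarrow> int" and r
    by (rule prod.cong) auto
  from x have "x 0 = 0 \<or> x 0 = 1/2" by (auto simp: space_tower_space)
  then show ?thesis
  proof
    assume x0: "x 0 = 0"
    have "(\<Prod>i\<in>{1..d}. e2pi (of_int (n i) * tower \<alpha> x i)) = (\<Prod>i\<in>{1..d}. e2pi (of_int (n i) * x i))"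
      by (rule prod.cong) (auto simp: tower_def x0)
    then show ?thesis unfolding torus_char_split upd
      by (simp add: tower_def x0)
  next
    assume x0: "x 0 = 1/2"
    have "(\<Prod>i\<in>{1..d}. e2pi (of_int (n i) * tower \<alpha> x i)) = (\<Prod>i\<in>{1..d}. e2pi (of_int (n i) * skew \<alpha> x i))"
      by (rule prod.cong) (auto simp: tower_def x0)
    also note prod_e2pi_skew[of n d, OF n]
    finally show ?thesis unfolding torus_char_split upd
      by (simp add: tower_def x0 n'_def)
  qed
qed

text \<open>By Fourier uniqueness it is enough that every character has the same integral under the
  measure and its image.\<close>

lemma mps_tower: "mps tower_space (tower \<alpha>)"
proof -
  let ?N = "distr tower_space tower_space (tower \<alpha>)"
  have eq: "(LINT x|?N. 1 * torus_char d n x) = (LINT x|tower_space. 1 * torus_char d n x)" for d n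
  proof -
    obtain m where m: "torus_char d n = torus_char (Suc (Suc d)) m" "\<And>i. i > d \<Longrightarrow> m i = 0"
      using torus_char_normal_form[of d n] by blast
    let ?d = "Suc d"
    define m' where "m' = (\<lambda>i. m i + m (Suc i))"
    \<comment> \<open>The unipotent map on exponents is injective: starting from the vanishing top
      exponent, all exponents vanish by descent.\<close>
    have "(\<forall>i\<in>{1..?d}. m' i = 0) \<longleftrightarrow> (\<forall>i\<in>{1..?d}. m i = 0)"
    proof
      assume m': "\<forall>i\<in>{1..?d}. m' i = 0"
      have "m i = 0" if "i \<le> ?d" "i \<ge> 1" for i
        using that
      proof (induction i rule: inc_induct)
        case base
        show ?case using m(2)[of ?d] by simp
      next
        case (step i)
        then have "m' i = 0" "m (Suc i) = 0" using m' by auto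
        then show ?case by (simp add: m'_def)
      qed
      then show "\<forall>i\<in>{1..?d}. m i = 0" by auto
    next
      assume "\<forall>i\<in>{1..?d}. m i = 0"
      then show "\<forall>i\<in>{1..?d}. m' i = 0"
        using m(2)[of "Suc ?d"] by (auto simp: m'_def le_Suc_eq)
    qed
    then have m0: "(\<forall>i\<in>{1..?d}. (m'(0 := r)) i = 0) \<longleftrightarrow> (\<forall>i\<in>{1..?d}. m i = 0)"
      "(\<forall>i\<in>{1..?d}. (m(0 := r)) i = 0) \<longleftrightarrow> (\<forall>i\<in>{1..?d}. m i = 0)" for r
      by auto
    have "(LINT x|?N. torus_char (Suc ?d) m x) = (LINT x|tower_space. torus_char (Suc ?d) m (tower \<alpha> x))"
      by (rule integral_distr) measurable
    also have "\<dots> = (LINT x|tower_space.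
       e2pi (of_int (m 0) / 2) / 2 * (torus_char (Suc ?d) (m(0 := 0)) x + torus_char (Suc ?d) (m(0 := 1)) x) +
    e2pi (of_int (m 1) * \<alpha>) / 2 * (torus_char (Suc ?d) (m'(0 := 0)) x - torus_char (Suc ?d) (m'(0 := 1)) x))"
      by (rule Bochner_Integration.integral_cong[OF refl])
        (use m(2) in \<open>simp add: torus_char_tower m'_def del: fun_upd_apply\<close>)
    also have "\<dots> = e2pi (of_int (m 0) / 2) / 2 *
       ((LINT x|tower_space. torus_char (Suc ?d) (m(0 := 0)) x) + (LINT x|tower_space. torus_char (Suc ?d) (m(0 := 1)) x)) +
      e2pi (of_int (m 1) * \<alpha>) / 2 *
       ((LINT x|tower_space. torus_char (Suc ?d) (m'(0 := 0)) x) - (LINT x|tower_space. torus_char (Suc ?d) (m'(0 := 1)) x))"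
      by simp
    also have "\<dots> = (LINT x|tower_space. torus_char (Suc ?d) m x)"
      unfolding integral_torus_char m0 by (auto simp: field_simps)
    finally show ?thesis using m(1) by simp
  qed
  interpret N: prob_space ?N by (rule tower_space.prob_space_distr) simp
  have "?N = tower_space"
  proof (rule measure_eqI)
    fix B assume "B \<in> sets ?N"
    then have B: "B \<in> sets tower_space" by simp
    have "(LINT x:B|?N. 1::complex) = (LINT x:B|tower_space. 1)"
      by (rule tower_fourier_uniqueness[OF _ refl _ _ eq B]) simp_all
    then have "measure ?N B = measure tower_space B"
      using B by (simp add: set_lebesgue_integral_def scaleR_conv_of_real)
    then show "emeasure ?N B = emeasure tower_space B"
      by (simp add: N.emeasure_eq_measure tower_space.emeasure_eq_measure)
  qed simp
  then show ?thesis by (simp add: mps_def tower_space.prob_space_axioms)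
qed

lemma mps_tower_square: "mps tower_space (tower \<alpha> ^^ 2)"
  by (intro mps_funpow mps_tower)

lemma tower_square: "x \<in> space tower_space \<Longrightarrow> (tower \<alpha> ^^ 2) x = skew \<alpha> x"
  by (simp add: numeral_2_eq_2 tower_tower)

text \<open>Differencing shifts all exponents down by one place and produces a constant factor, so
  after \<open>j\<close> differences only the exponent \<open>n j\<close>, paired with \<alpha>,
  remains.\<close>

lemma poly_phase_torus_char:
  assumes "1 \<le> j" "j \<le> d" "\<And>i. i > j \<Longrightarrow> n i = 0"
  shows "poly_phase tower_space (tower \<alpha> ^^ 2) j (e2pi (of_int (n j) * \<alpha>)) (torus_char (Suc d) n)"
  using assms
proof (induction j arbitrary: n rule: nat_induct_at_least)
  case base
  have "torus_char (Suc d) n ((tower \<alpha> ^^ 2) x) * cnj (torus_char (Suc d) n x) = e2pi (of_int (n 1) * \<alpha>)"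
    if "x \<in> space tower_space" for x
  proof -
    have "(\<Prod>i\<in>{1..d}. e2pi (of_int (n i + n (Suc i)) * x i)) = (\<Prod>i\<in>{1..d}. e2pi (of_int (n i) * x i))"
      using base by (intro prod.cong) auto
    then have "torus_char (Suc d) n (skew \<alpha> x) = e2pi (of_int (n 1) * \<alpha>) * torus_char (Suc d) n x"
      unfolding torus_char_split using prod_e2pi_skew[of n d \<alpha> x] base by (simp add: skew_def mult_ac)
    then show ?thesis using that by (simp add: tower_square mult_cnj_eq_1)
  qed
  then show ?case by (auto intro!: AE_I2)
next
  case (Suc j)
  \<comment> \<open>The floor is fixed by the square of the tower map, so its factor cancels in the
    difference; hence exponent 0 at place 0.\<close>
  define n' where "n' i = (if i = 0 then 0 else n (Suc i))" for i
  have eq: "torus_char (Suc d) n ((tower \<alpha> ^^ 2) x) * cnj (torus_char (Suc d) n x) =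
     e2pi (of_int (n 1) * \<alpha>) * torus_char (Suc d) n' x"
    if "x \<in> space tower_space" for x
  proof -
    have "(\<Prod>i\<in>{1..d}. e2pi (of_int (n i + n (Suc i)) * x i)) =
      (\<Prod>i\<in>{1..d}. e2pi (of_int (n i) * x i)) * (\<Prod>i\<in>{1..d}. e2pi (of_int (n' i) * x i))"
      unfolding prod.distrib[symmetric] by (intro prod.cong) (auto simp: n'_def ring_distribs e2pi_add)
    then have "torus_char (Suc d) n (skew \<alpha> x) =
        e2pi (of_int (n 1) * \<alpha>) * torus_char (Suc d) n' x * torus_char (Suc d) n x"
      unfolding torus_char_split using prod_e2pi_skew[of n d \<alpha> x] Suc.prems
      by (simp add: skew_def n'_def mult_ac)
    then show ?thesis using that by (simp add: tower_square mult_cnj_eq_1)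
  qed
  note [measurable] = mps_measurable[OF mps_tower_square]
  have n': "n' j = n (Suc j)" using Suc.hyps by (simp add: n'_def)
  have "poly_phase tower_space (tower \<alpha> ^^ 2) j (e2pi (of_int (n' j) * \<alpha>)) (torus_char (Suc d) n')"
    using Suc.prems by (intro Suc.IH) (auto simp: n'_def)
  moreover have "poly_phase tower_space (tower \<alpha> ^^ 2) j 1 (\<lambda>_. e2pi (of_int (n 1) * \<alpha>))"
    using poly_phase_const[of "e2pi (of_int (n 1) * \<alpha>)" _ _ "j - 1"] Suc.hyps by simp
  ultimately have "poly_phase tower_space (tower \<alpha> ^^ 2) j (e2pi (of_int (n (Suc j)) * \<alpha>))
      (\<lambda>x. e2pi (of_int (n 1) * \<alpha>) * torus_char (Suc d) n' x)"
    using poly_phase_mult[of _ _ j 1 _ "e2pi (of_int (n' j) * \<alpha>)"] n' by fastforce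
  then have "poly_phase tower_space (tower \<alpha> ^^ 2) j (e2pi (of_int (n (Suc j)) * \<alpha>))
     (\<lambda>x. torus_char (Suc d) n ((tower \<alpha> ^^ 2) x) * cnj (torus_char (Suc d) n x))"
    by (rule poly_phase_cong_AE[OF mps_tower_square]) (auto intro!: AE_I2 simp: eq)
  then show ?case by simp
qed

section \<open>Ergodicity and orthogonality\<close>

lemma e2pi_irrational: "\<alpha> \<notin> \<rat> \<Longrightarrow> n \<noteq> 0 \<Longrightarrow> e2pi (of_int n * \<alpha>) \<noteq> 1"
proof
  assume *: "\<alpha> \<notin> \<rat>" "n \<noteq> 0" "e2pi (of_int n * \<alpha>) = 1"
  then obtain m where "of_int n * \<alpha> = of_int m" by (auto simp: e2pi_eq_1_iff elim: Ints_cases)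
  then have "\<alpha> = of_int m / of_int n" using * by (simp add: field_simps)
  then have "\<alpha> \<in> \<rat>" by simp
  with * show False by simp
qed

lemma e2pi_eq_minus_1: "t * 2 = 1 \<Longrightarrow> e2pi t = - 1"
proof -
  assume "t * 2 = 1"
  then have "t = 1/2" by simp
  then show "e2pi t = - 1" by (simp only: e2pi_half)
qed

text \<open>If the character has degree at least two, the product with \<open>u\<close> inherits its
  final constant, which is not a root of unity. Otherwise the product is an eigenfunction with
  eigenvalue different from 1.\<close>

lemma integral_eigenfunction_torus_char:
  assumes irr: "\<alpha> \<notin> \<rat>" and u: "poly_phase tower_space (tower \<alpha> ^^ 2) 1 c u" and c: "cmod c = 1"
    and n: "\<And>i. i > d \<Longrightarrow> n i = 0" and d: "d \<ge> 1"
    and nontriv: "c * e2pi (of_int (n 1) * \<alpha>) \<noteq> 1 \<or> (\<exists>i\<ge>2. n i \<noteq> 0)"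
  shows "(LINT x|tower_space. u x * torus_char (Suc d) n x) = 0"
proof (cases "\<exists>i\<ge>2. n i \<noteq> 0")
  case True
  then obtain i where i: "i \<ge> 2" "n i \<noteq> 0" by blast
  \<comment> \<open>The last place with nonzero exponent is the degree of the character as a
    phase.\<close>
  define j where "j = Max {i. n i \<noteq> 0}"
  have fin: "finite {i. n i \<noteq> 0}"
  proof (rule finite_subset)
    show "{i. n i \<noteq> 0} \<subseteq> {..d}" using n by (force simp flip: not_less)
  qed simp
  have le: "i \<le> j" if "n i \<noteq> 0" for i
    unfolding j_def using that by (intro Max_ge[OF fin]) simp
  have "j \<in> {i. n i \<noteq> 0}"
    unfolding j_def using i by (intro Max_in[OF fin]) auto
  then have j: "j \<ge> 2" "n j \<noteq> 0" "\<And>i. i > j \<Longrightarrow> n i = 0"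
    using le[OF i(2)] i(1) le leD by auto
  have "j \<le> d" using n[of j] j(2) by force
  obtain k where k: "j = Suc (Suc k)" using j(1) by (metis Suc_le_D numeral_2_eq_2 Suc_le_mono)
  have "poly_phase tower_space (tower \<alpha> ^^ 2) (Suc (Suc k)) (1 * e2pi (of_int (n j) * \<alpha>))
      (\<lambda>x. u x * torus_char (Suc d) n x)"
    using poly_phase_mult[OF poly_phase_eigen[OF mps_tower_square u c, of k]
        poly_phase_torus_char[of j d n \<alpha>, unfolded k]] j \<open>j \<le> d\<close> k by simp
  then show ?thesis
  proof (rule integral_poly_phase_eq_0[OF mps_tower_square])
    fix r :: nat assume "r > 0"
    then have "int r * n j \<noteq> 0" using j by simp
    from e2pi_irrational[OF irr this] show "(1 * e2pi (of_int (n j) * \<alpha>)) ^ r \<noteq> 1"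
      by (simp add: e2pi_power mult.assoc)
  qed
next
  case False
  then have "\<And>i. i > 1 \<Longrightarrow> n i = 0" by (metis Suc_1 Suc_leI)
  then have "poly_phase tower_space (tower \<alpha> ^^ 2) 1 (c * e2pi (of_int (n 1) * \<alpha>)) (\<lambda>x. u x * torus_char (Suc d) n x)"
    using d by (intro poly_phase_mult u poly_phase_torus_char) auto
  then show ?thesis
    by (rule integral_poly_phase_1[OF mps_tower_square]) (use nontriv False in blast)
qed

text \<open>If the square of \<open>c\<close> were not of this form, \<open>u\<close> would be
  orthogonal to all characters and so vanish almost everywhere, although it is unimodular.\<close>

lemma tower_eigenvalue:
  assumes irr: "\<alpha> \<notin> \<rat>" and u: "poly_phase tower_space (tower \<alpha>) 1 c u"
  obtains m :: int where "c\<^sup>2 = e2pi (of_int m * \<alpha>)"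
proof (rule ccontr)
  assume "\<not> thesis"
  then have ne: "c\<^sup>2 \<noteq> e2pi (of_int m * \<alpha>)" for m using that by blast
  have u1: "AE x in tower_space. cmod (u x) = 1" and um [measurable]: "u \<in> borel_measurable tower_space"
    and uc: "AE x in tower_space. u (tower \<alpha> x) * cnj (u x) = c"
    using u by auto
  have "AE x in tower_space. cmod c = 1"
    using uc u1 mps_AE[OF mps_tower u1, of \<alpha>] by eventually_elim (auto simp: norm_mult)
  then have c: "cmod (c\<^sup>2) = 1" by (simp add: norm_power)
  have u2: "poly_phase tower_space (tower \<alpha> ^^ 2) 1 (c\<^sup>2) u"
    using poly_phase_square[OF mps_tower u] by simp
  have iu: "integrable tower_space u"
    by (rule tower_space.integrable_const_bound[where B=1]) (use u1 in auto)
  have "AE x in tower_space. u x = 0"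
  proof (rule tower_space.density_zero[OF iu])
    fix B assume B: "B \<in> sets tower_space"
    have "(LINT x:B|tower_space. u x) = (LINT x:B|tower_space. 0)"
    proof (rule tower_fourier_uniqueness[OF refl refl iu _ _ B])
      fix d n
      obtain m where m: "torus_char d n = torus_char (Suc (Suc d)) m" "\<And>i. i > d \<Longrightarrow> m i = 0"
        using torus_char_normal_form[of d n] by blast
      have "c\<^sup>2 * e2pi (of_int (m 1) * \<alpha>) \<noteq> 1"
      proof
        assume "c\<^sup>2 * e2pi (of_int (m 1) * \<alpha>) = 1"
        then have "c\<^sup>2 * (e2pi (of_int (m 1) * \<alpha>) * e2pi (of_int (- m 1) * \<alpha>)) = e2pi (of_int (- m 1) * \<alpha>)"
          by (metis mult.assoc mult_1)
        then show False using ne[of "- m 1"] by (simp flip: e2pi_add)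
      qed
      then show "(LINT x|tower_space. u x * torus_char d n x) = (LINT x|tower_space. 0 * torus_char d n x)"
        using integral_eigenfunction_torus_char[OF irr u2 c, of "Suc d" m] m by simp
    qed simp
    then show "(LINT x:B|tower_space. u x) = 0" by (simp add: set_lebesgue_integral_def)
  qed
  with u1 have "AE x in tower_space. False" by eventually_elim simp
  then show False by simp
qed

text \<open>An invariant set \<open>A\<close> gives the invariant unimodular function \<open>2 \<cdot> 1\<^sub>A - 1\<close>; its Fourier coefficients
  agree with those of its mean.\<close>

lemma ergodic_tower:
  assumes irr: "\<alpha> \<notin> \<rat>"
  shows "ergodic tower_space (tower \<alpha>)"
  unfolding ergodic_def
proof (intro conjI ballI impI mps_tower)
  fix A assume A [measurable]: "A \<in> sets tower_space" and inv: "tower \<alpha> -` A \<inter> space tower_space = A"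
  define u :: "(nat \<Rightarrow> real) \<Rightarrow> complex" where "u x = 2 * complex_of_real (indicator A x) - 1" for x
  have u [measurable]: "u \<in> borel_measurable tower_space" unfolding u_def by measurable
  have u1: "cmod (u x) = 1" for x by (auto simp: u_def indicator_def)
  have iu: "integrable tower_space u"
    by (rule tower_space.integrable_const_bound[where B=1]) (auto simp: u1)
  define a where "a = measure tower_space A"
  have Iu: "(LINT x|tower_space. u x) = 2 * a - 1"
  proof -
    have "integrable tower_space (\<lambda>x. complex_of_real (indicator A x))"
      by (rule tower_space.integrable_const_bound[where B=1]) (auto simp: indicator_def)
    then show ?thesis by (simp add: u_def a_def tower_space.prob_space)
  qed
  have uT: "u (tower \<alpha> x) = u x" if "x \<in> space tower_space" for x
    using inv that by (auto simp: u_def indicator_def)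
  have uS: "poly_phase tower_space (tower \<alpha> ^^ 2) 1 1 u"
  proof -
    have "u ((tower \<alpha> ^^ 2) x) * cnj (u x) = 1" if "x \<in> space tower_space" for x
      using that by (simp add: numeral_2_eq_2 uT tower_in_space mult_cnj_eq_1 u1)
    moreover note [measurable] = mps_measurable[OF mps_tower_square]
    ultimately show ?thesis by (auto simp: u1 intro!: AE_I2)
  qed
  have "(LINT x:A|tower_space. u x) = (LINT x:A|tower_space. complex_of_real (2 * a - 1))"
  proof (rule tower_fourier_uniqueness[OF refl refl iu _ _ A])
    fix d n
    obtain m where m: "torus_char d n = torus_char (Suc (Suc d)) m" "\<And>i. i > d \<Longrightarrow> m i = 0"
      using torus_char_normal_form[of d n] by blast
    let ?c = "torus_char (Suc (Suc d)) m"
    define \<kappa> where "\<kappa> = e2pi (of_int (m 0) / 2)"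
    have \<kappa>: "\<kappa> * \<kappa> = 1" by (simp add: \<kappa>_def flip: e2pi_add)
    have "(LINT x|tower_space. u x * ?c x) = (2 * a - 1) * (LINT x|tower_space. ?c x)"
    proof (cases "\<exists>i\<in>{1..Suc d}. m i \<noteq> 0")
      case True
      have "(LINT x|tower_space. u x * ?c x) = 0"
      proof (rule integral_eigenfunction_torus_char[OF irr uS])
        show "1 * e2pi (of_int (m 1) * \<alpha>) \<noteq> 1 \<or> (\<exists>i\<ge>2. m i \<noteq> 0)"
        proof (cases "m 1 = 0")
          case True
          obtain i where i: "i \<in> {1..Suc d}" "m i \<noteq> 0" using \<open>\<exists>i\<in>_. _\<close> by blast
          with True have "i \<ge> 2" by (cases "i = 1") auto
          with i show ?thesis by blast
        qed (simp add: e2pi_irrational[OF irr])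
      qed (use m in auto)
      moreover have "(LINT x|tower_space. ?c x) = 0"
        unfolding integral_torus_char using True by meson
      ultimately show ?thesis by simp
    next
      case False
      then have cx: "?c x = e2pi (of_int (m 0) * x 0)" for x
        unfolding torus_char_split by simp
      have c0: "?c x = 1" if "x 0 = 0" for x unfolding cx that by simp
      have c1: "?c x = \<kappa>" if "x 0 = 1/2" for x unfolding cx that \<kappa>_def by simp
      \<comment> \<open>The tower map exchanges the floors; going down also contributes \<kappa>,
        because its square is 1.\<close>
      have cT: "?c (tower \<alpha> x) = \<kappa> * ?c x" if "x \<in> space tower_space" for x
      proof -
        from that have "x 0 = 0 \<or> x 0 = 1/2" by (auto simp: space_tower_space)
        then show ?thesis
        proof
          assume x0: "x 0 = 0"
          then have "tower \<alpha> x 0 = 1/2" by (simp add: tower_def)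
          from c1[of "tower \<alpha> x", OF this] c0[of x, OF x0] show ?thesis by simp
        next
          assume x0: "x 0 = 1/2"
          then have "tower \<alpha> x 0 = 0" by (simp add: tower_def)
          from c0[of "tower \<alpha> x", OF this] c1[of x, OF x0] \<kappa> show ?thesis by simp
        qed
      qed
      have Ic: "(LINT x|tower_space. ?c x) = (1 + \<kappa>) / 2"
      proof -
        have "\<forall>i\<in>{1..Suc d}. m i = 0" using False by blast
        then show ?thesis unfolding integral_torus_char \<kappa>_def by (rule if_P)
      qed
      show ?thesis
      proof (cases "\<kappa> = 1")
        case True
        have "(LINT x|tower_space. u x * ?c x) = (LINT x|tower_space. u x)"
        proof (rule Bochner_Integration.integral_cong[OF refl])
          fix x assume "x \<in> space tower_space"
          then have "x 0 = 0 \<or> x 0 = 1/2" by (auto simp: space_tower_space)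
          then have "?c x = 1" using True c0 c1 by (elim disjE) simp_all
          then show "u x * ?c x = u x" by simp
        qed
        then show ?thesis using True by (simp add: Iu Ic)
      next
        case False
        then have \<kappa>': "\<kappa> = -1" using \<kappa> by (simp add: square_eq_1_iff)
        \<comment> \<open>Here the character changes sign under the tower map while \<open>u\<close>
          is invariant, so the integral equals its own negative.\<close>
        have "(LINT x|tower_space. u x * ?c x) = (LINT x|tower_space. u (tower \<alpha> x) * ?c (tower \<alpha> x))"
          by (rule mps_integral[OF mps_tower, symmetric]) measurable
        also have "\<dots> = (LINT x|tower_space. - (u x * ?c x))"
          by (rule Bochner_Integration.integral_cong[OF refl]) (simp add: uT cT \<kappa>')
        finally have "(LINT x|tower_space. u x * ?c x) = 0" by simp
        then show ?thesis by (simp add: Ic \<kappa>')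
      qed
    qed
    then show "(LINT x|tower_space. u x * torus_char d n x) = (LINT x|tower_space. complex_of_real (2 * a - 1) * torus_char d n x)"
      by (simp add: m(1))
  qed simp
  \<comment> \<open>On \<open>A\<close> the function \<open>u\<close> is 1. Comparing the two values
    of the integral gives a quadratic equation for \<open>a\<close> with roots 0 and 1.\<close>
  moreover have "(LINT x:A|tower_space. u x) = (LINT x:A|tower_space. 1)"
    unfolding set_lebesgue_integral_def
    by (rule Bochner_Integration.integral_cong) (auto simp: u_def indicator_def)
  ultimately have "complex_of_real a = complex_of_real (a * (2 * a - 1))"
    using A by (simp add: set_lebesgue_integral_def a_def scaleR_conv_of_real)
  then have "a = a * (2 * a - 1)" by (simp only: of_real_eq_iff)
  then show "measure tower_space A = 0 \<or> measure tower_space A = 1"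
    unfolding a_def[symmetric] by algebra
qed

section \<open>The test function and its orthogonality relations\<close>

lemma poly_phase_top_difference: "poly_phase M S (Suc k) c h \<Longrightarrow> \<exists>u. poly_phase M S 1 c u"
proof (induction k arbitrary: h)
  case (Suc k)
  from Suc.prems have "poly_phase M S (Suc k) c (\<lambda>x. h (S x) * cnj (h x))" by simp
  then show ?case by (rule Suc.IH)
qed auto

text \<open>For positive \<open>k\<close> this is the character e(r x_0 + x_k); the values 0 and 1
  of \<open>r\<close> together resolve the two floors.\<close>

definition last_phase :: "nat \<Rightarrow> int \<Rightarrow> (nat \<Rightarrow> real) \<Rightarrow> complex" where
  "last_phase k r = torus_char (Suc k) (\<lambda>i. if i = 0 then r else if i = k then 1 else 0)"

definition half_phase :: "nat \<Rightarrow> (nat \<Rightarrow> real) \<Rightarrow> complex" where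
  "half_phase k x = (if x 0 = 0 then e2pi (x k) else 0)"

lemma last_phase_eq: "k \<ge> 1 \<Longrightarrow> last_phase k r x = e2pi (of_int r * x 0) * e2pi (x k)"
proof -
  assume k: "k \<ge> 1"
  have "(\<Prod>i\<in>{1..k}. e2pi (of_int (if i = 0 then r else if i = k then 1 else 0) * x i)) =
      (\<Prod>i\<in>{1..k}. if i = k then e2pi (x i) else 1)"
    by (rule prod.cong) auto
  also have "\<dots> = e2pi (x k)" using k by (simp add: prod.delta)
  finally show ?thesis unfolding last_phase_def torus_char_split by simp
qed

lemma half_phase_eq:
  assumes "k \<ge> 1" "x \<in> space tower_space"
  shows "half_phase k x = (last_phase k 0 x + last_phase k 1 x) / 2"
proof -
  from assms(2) have "x 0 = 0 \<or> x 0 = 1/2" by (auto simp: space_tower_space)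
  then show ?thesis using assms(1)
    by (elim disjE) (simp_all add: half_phase_def last_phase_eq e2pi_eq_minus_1)
qed

lemma poly_phase_last_phase:
  "k \<ge> 1 \<Longrightarrow> poly_phase tower_space (tower \<alpha> ^^ 2) k (e2pi \<alpha>) (last_phase k r)"
  unfolding last_phase_def
  using poly_phase_torus_char[of k k "\<lambda>i. if i = 0 then r else if i = k then 1 else 0" \<alpha>] by simp

lemma measurable_half_phase [measurable]: "half_phase k \<in> borel_measurable tower_space"
proof -
  note [measurable] = tower_coordinate_measurable
  show ?thesis unfolding half_phase_def[abs_def] by measurable
qed

lemma norm_half_phase: "cmod (half_phase k x) \<le> 1"
  by (simp add: half_phase_def)

lemma integrable_half_phase: "integrable tower_space (half_phase k)"
  by (rule tower_space.integrable_const_bound[where B=1]) (auto simp: norm_half_phase)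

text \<open>By \<open>half_phase_eq\<close> only the two characters \<open>last_phase\<close> must
  be tested, and both have final constant e(\<alpha>) under the square of the tower map.\<close>

lemma half_phase_E_perp:
  assumes irr: "\<alpha> \<notin> \<rat>" and k: "k \<ge> 2"
  shows "half_phase k \<in> E_perp tower_space k (tower \<alpha>)"
  unfolding E_perp_def
proof (intro CollectI conjI ballI integrable_half_phase)
  fix h assume "h \<in> E tower_space k (tower \<alpha>)"
  then obtain c where h: "poly_phase tower_space (tower \<alpha>) k c h" by (auto simp: E_iff_poly_phase)
  \<comment> \<open>One factor 2 of the exponent \<open>2 ^ k\<close> is spent on squaring
    \<open>c\<close>; since \<open>k\<close> is at least 2, the remaining power of 2 is still
    even.\<close>
  obtain j where j: "k = Suc (Suc j)" using k by (metis Suc_le_D numeral_2_eq_2 Suc_le_mono)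
  obtain u where "poly_phase tower_space (tower \<alpha>) 1 c u"
    using poly_phase_top_difference h j by blast
  then obtain m :: int where m: "c\<^sup>2 = e2pi (of_int m * \<alpha>)" by (rule tower_eigenvalue[OF irr])
  have "c ^ 2 ^ k = (c\<^sup>2) ^ 2 ^ Suc j" by (simp add: j flip: power_mult)
  also have "\<dots> = e2pi (of_int (2 ^ Suc j * m) * \<alpha>)" unfolding m e2pi_power by (simp add: mult.assoc)
  finally have hS: "poly_phase tower_space (tower \<alpha> ^^ 2) k (e2pi (of_int (2 ^ Suc j * m) * \<alpha>)) h"
    using poly_phase_square[OF mps_tower h] by metis
  let ?l = "1 - 2 ^ Suc j * m"
  \<comment> \<open>Parity alone makes the exponent of the product nonzero, whatever
    \<open>m\<close> is.\<close>
  have "odd ?l" by simp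
  then have l: "?l \<noteq> 0" by (metis even_zero)
  have hm [measurable]: "h \<in> borel_measurable tower_space" using h by (rule poly_phase_measurable)
  have h1: "AE x in tower_space. cmod (h x) = 1" using h j by simp
  have lm [measurable]: "last_phase k r \<in> borel_measurable tower_space" for r
    unfolding last_phase_def by measurable
  have int: "integrable tower_space (\<lambda>x. last_phase k r x * cnj (h x))" for r
    by (rule tower_space.integrable_const_bound[where B=1])
      (use h1 in \<open>auto simp: norm_mult last_phase_def\<close>)
  have zero: "(LINT x|tower_space. last_phase k r x * cnj (h x)) = 0" for r
  proof -
    have "e2pi \<alpha> * cnj (e2pi (of_int (2 ^ Suc j * m) * \<alpha>)) = e2pi (of_int ?l * \<alpha>)"
      unfolding e2pi_minus[symmetric] e2pi_add[symmetric] by (simp add: algebra_simps)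
    then have "poly_phase tower_space (tower \<alpha> ^^ 2) (Suc (Suc j)) (e2pi (of_int ?l * \<alpha>)) (\<lambda>x. last_phase k r x * cnj (h x))"
      using poly_phase_mult[OF poly_phase_last_phase[of k \<alpha> r] poly_phase_cnj[OF hS]] j by simp
    then show ?thesis
    proof (rule integral_poly_phase_eq_0[OF mps_tower_square])
      fix r :: nat assume "r > 0"
      then have "int r * ?l \<noteq> 0" using l by simp
      from e2pi_irrational[OF irr this] show "e2pi (of_int ?l * \<alpha>) ^ r \<noteq> 1"
        by (simp add: e2pi_power mult.assoc)
    qed
  qed
  have "(LINT x|tower_space. half_phase k x * cnj (h x)) =
     (LINT x|tower_space. (last_phase k 0 x * cnj (h x) + last_phase k 1 x * cnj (h x)) / 2)"
  proof (rule Bochner_Integration.integral_cong[OF refl])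
    fix x assume "x \<in> space tower_space"
    then have x: "half_phase k x = (last_phase k 0 x + last_phase k 1 x) / 2"
      using k by (intro half_phase_eq) auto
    show "half_phase k x * cnj (h x) = (last_phase k 0 x * cnj (h x) + last_phase k 1 x * cnj (h x)) / 2"
      unfolding x by (simp add: ring_distribs)
  qed
  then show "(LINT x|tower_space. half_phase k x * cnj (h x)) = 0"
    by (simp add: int zero)
qed

text \<open>The indicator of the lower floor is the mean of the trivial character and the floor
  character.\<close>

lemma measure_lower_half: "measure tower_space {x \<in> space tower_space. x 0 = 0} = 1/2"
proof -
  let ?A = "{x \<in> space tower_space. x 0 = 0}"
  note [measurable] = tower_coordinate_measurable
  have [measurable]: "?A \<in> sets tower_space" by measurable
  have char: "torus_char (Suc 0) n x = e2pi (of_int (n 0) * x 0)" for n x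
    by (simp add: torus_char_def)
  have "complex_of_real (measure tower_space ?A) = (LINT x|tower_space. complex_of_real (indicator ?A x))"
    by simp
  also have "\<dots> = (LINT x|tower_space. (torus_char (Suc 0) (\<lambda>_. 0) x + torus_char (Suc 0) (\<lambda>_. 1) x) / 2)"
    by (rule Bochner_Integration.integral_cong[OF refl]) (auto simp: indicator_def char space_tower_space e2pi_eq_minus_1)
  also have "\<dots> = 1/2"
    by (simp add: integral_torus_char)
  finally have "complex_of_real (measure tower_space ?A) = complex_of_real (1/2)" by simp
  then show ?thesis by (simp only: of_real_eq_iff)
qed

text \<open>The pairing with e(x_k) itself is the measure of the lower floor. That e(x_k) belongs to
  the class is due to e(\<alpha>) being an eigenvalue, with eigenfunction e(x_1).\<close>

lemma half_phase_not_E_perp: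
  assumes k: "k \<ge> 1"
  shows "half_phase k \<notin> E_perp tower_space k (tower \<alpha> ^^ 2)"
proof
  assume perp: "half_phase k \<in> E_perp tower_space k (tower \<alpha> ^^ 2)"
  note [measurable] = tower_coordinate_measurable
  have "eigenvalue tower_space (tower \<alpha> ^^ 2) (e2pi \<alpha>)"
    unfolding eigenvalue_def
  proof (intro exI conjI)
    show "(\<lambda>x. e2pi (x 1)) \<in> borel_measurable tower_space" by measurable
    show "\<not> (AE x in tower_space. e2pi (x 1) = 0)"
    proof
      assume "AE x in tower_space. e2pi (x 1) = 0"
      then have "AE x in tower_space. False"
        by eventually_elim (metis norm_e2pi norm_zero zero_neq_one)
      then show False by simp
    qed
    show "AE x in tower_space. e2pi ((tower \<alpha> ^^ 2) x 1) = e2pi \<alpha> * e2pi (x 1)"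
      by (rule AE_I2) (simp add: tower_square skew_def e2pi_add mult.commute)
  qed simp
  then have "last_phase k 0 \<in> E tower_space k (tower \<alpha> ^^ 2)"
    using poly_phase_last_phase[OF k] by (auto simp: E_iff_poly_phase)
  with perp have "0 = (LINT x|tower_space. half_phase k x * cnj (last_phase k 0 x))"
    by (simp add: E_perp_def)
  also have "\<dots> = (LINT x|tower_space. complex_of_real (indicator {x \<in> space tower_space. x 0 = 0} x))"
    by (rule Bochner_Integration.integral_cong[OF refl])
      (use k in \<open>auto simp: half_phase_def last_phase_eq indicator_def mult_cnj_eq_1\<close>)
  also have "\<dots> = complex_of_real (1/2)"
    by (simp add: measure_lower_half)
  finally show False by simp
qed

text \<open>Each floor is invariant under the square of the tower map.\<close>

lemma not_totally_ergodic_tower: "\<not> totally_ergodic tower_space (tower \<alpha>)"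
proof
  let ?A = "{x \<in> space tower_space. x 0 = 0}"
  note [measurable] = tower_coordinate_measurable
  assume "totally_ergodic tower_space (tower \<alpha>)"
  then have "ergodic tower_space (tower \<alpha> ^^ 2)" by (simp add: totally_ergodic_def)
  moreover have "?A \<in> sets tower_space" by measurable
  moreover have "(tower \<alpha> ^^ 2) -` ?A \<inter> space tower_space = ?A"
    by (auto simp: tower_square skew_in_space) (auto simp: skew_def)
  ultimately have "measure tower_space ?A = 0 \<or> measure tower_space ?A = 1"
    unfolding ergodic_def by blast
  then show False using measure_lower_half by simp
qed

section \<open>Polynomial averages along orbits\<close>

definition binomial_poly :: "nat \<Rightarrow> real poly" where
  "binomial_poly j = smult (1 / fact j) (\<Prod>i<j. [:- of_nat i, 1:])"

lemma poly_binomial_poly: "poly (binomial_poly j) (of_nat m) = of_nat (m choose j)"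
  by (simp add: binomial_poly_def poly_prod binomial_gbinomial gbinomial_prod_rev atLeast0LessThan
      mult.commute)

lemma degree_binomial_poly: "degree (binomial_poly j) \<le> j"
proof -
  have "degree (\<Prod>i<j. [:- of_nat i, 1 :: real:]) \<le> j"
    using degree_prod_sum_le[of "{..<j}" "\<lambda>i. [:- of_nat i, 1 :: real:]"] by simp
  then show ?thesis unfolding binomial_poly_def using degree_smult_le order_trans by blast
qed

lemma skew_funpow_in_space: "x \<in> space tower_space \<Longrightarrow> (skew \<alpha> ^^ m) x \<in> space tower_space"
  by (induction m) (auto intro: skew_in_space)

lemma skew_funpow_0 [simp]: "(skew \<alpha> ^^ m) x 0 = x 0"
  by (induction m) (auto simp: skew_def)

lemma tower_funpow_even:
  "x \<in> space tower_space \<Longrightarrow> (tower \<alpha> ^^ (2 * m)) x = (skew \<alpha> ^^ m) x"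
proof (induction m)
  case (Suc m)
  have "(tower \<alpha> ^^ (2 * Suc m)) x = (tower \<alpha> ^^ 2) ((tower \<alpha> ^^ (2 * m)) x)"
    by (simp add: numeral_2_eq_2)
  then show ?case using Suc by (simp add: tower_square skew_funpow_in_space)
qed simp

text \<open>Pascal's rule in the number of steps. The formula holds only modulo 1, because of the
  fractional parts, hence the statement under \<open>e2pi\<close>.\<close>

lemma e2pi_skew_funpow:
  fixes \<alpha> x
  defines "y \<equiv> (\<lambda>i. if i = 0 then \<alpha> else x i)"
  assumes "k \<ge> 1"
  shows "e2pi ((skew \<alpha> ^^ m) x k) = e2pi (\<Sum>j\<le>k. of_nat (m choose j) * y (k - j))"
proof -
  \<comment> \<open>Replacing the floor by \<alpha> makes the recursion uniform and lets the
    induction include place 0.\<close>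
  define z where "z m i = (if i = 0 then \<alpha> else (skew \<alpha> ^^ m) x i)" for m i
  have "e2pi (z m k) = e2pi (\<Sum>j\<le>k. of_nat (m choose j) * y (k - j))" for k
  proof (induction m arbitrary: k)
    case 0
    have "(\<Sum>j\<le>k. of_nat (0 choose j) * y (k - j)) = (\<Sum>j\<le>k. if j = 0 then y k else 0)"
      by (rule sum.cong) auto
    then show ?case by (simp add: y_def z_def)
  next
    case (Suc m)
    show ?case
    proof (cases k)
      case 0
      then show ?thesis by (simp add: y_def z_def)
    next
      case (Suc l)
      have "e2pi (z (Suc m) k) = e2pi (z m (Suc l)) * e2pi (z m l)"
        using Suc by (simp add: z_def skew_def e2pi_add)
      also have "\<dots> = e2pi ((\<Sum>j\<le>Suc l. of_nat (m choose j) * y (Suc l - j)) + (\<Sum>j\<le>l. of_nat (m choose j) * y (l - j)))"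
        by (simp only: Suc.IH e2pi_add)
      also have "(\<Sum>j\<le>Suc l. real (m choose j) * y (Suc l - j)) + (\<Sum>j\<le>l. of_nat (m choose j) * y (l - j)) =
          (\<Sum>j\<le>Suc l. of_nat (Suc m choose j) * y (Suc l - j))"
        unfolding sum.atMost_Suc_shift by (simp add: sum.distrib[symmetric] ring_distribs add_ac)
      finally show ?thesis using Suc by simp
    qed
  qed
  from this[of k] show ?thesis using assms by (simp add: z_def)
qed

text \<open>At odd times the orbit is on the upper floor and contributes 0; at even times
  \<open>P\<close> cancels the phase and the contribution is 1. The averages over even
  \<open>N\<close> are therefore 1/2.\<close>

lemma half_phase_averages:
  assumes k: "k \<ge> 1" and x: "x \<in> space tower_space" "x 0 = 0"
  obtains P :: "real poly" where "degree P \<le> k"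
    "\<not> (\<lambda>N. (\<Sum>n=1..N. e2pi (poly P (real n)) * half_phase k ((tower \<alpha> ^^ n) x)) / of_nat N) \<longlonglongrightarrow> 0"
proof
  define y where "y = (\<lambda>i. if i = 0 then \<alpha> else x i)"
  \<comment> \<open>Minus the polynomial of \<open>e2pi_skew_funpow\<close>, with half the argument
    inserted because \<open>2 * m\<close> steps of the tower are \<open>m\<close> steps of the skew
    product.\<close>
  define P where "P = (\<Sum>j\<le>k. smult (- y (k - j)) (pcompose (binomial_poly j) [:0, 1/2:]))"
  show "degree P \<le> k"
    unfolding P_def
  proof (rule degree_sum_le)
    fix j assume "j \<in> {..k}"
    then have "degree (binomial_poly j) \<le> k" using degree_binomial_poly[of j] by simp
    then show "degree (smult (- y (k - j)) (pcompose (binomial_poly j) [:0, 1/2:])) \<le> k"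
      using degree_smult_le[of "- y (k - j)" "pcompose (binomial_poly j) [:0, 1/2:]"]
      by (simp add: degree_pcompose)
  qed simp
  have P: "poly P (real (2 * m)) = - (\<Sum>j\<le>k. of_nat (m choose j) * y (k - j))" for m
    by (simp add: P_def poly_sum poly_pcompose poly_binomial_poly sum_negf mult.commute)
  define g where "g n = e2pi (poly P (real n)) * half_phase k ((tower \<alpha> ^^ n) x)" for n
  have even: "g (2 * m) = 1" for m
  proof -
    have "g (2 * m) = e2pi (poly P (real (2 * m))) * e2pi (\<Sum>j\<le>k. of_nat (m choose j) * y (k - j))"
      unfolding g_def tower_funpow_even[OF x(1)] half_phase_def skew_funpow_0 y_def e2pi_skew_funpow[OF k, where \<alpha>=\<alpha> and m=m and x=x]
      using x by simp
    then show ?thesis unfolding P by (simp flip: e2pi_add)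
  qed
  have odd: "g (Suc (2 * m)) = 0" for m
  proof -
    have "(tower \<alpha> ^^ Suc (2 * m)) x 0 = 1/2"
      using tower_funpow_even[OF x(1), where \<alpha>=\<alpha> and m=m] x by (simp add: tower_def)
    then show ?thesis by (simp add: g_def half_phase_def)
  qed
  have sum: "(\<Sum>n=1..2*L. g n) = of_nat L" for L
    by (induction L) (use even[of "Suc _"] odd in auto)
  show "\<not> (\<lambda>N. (\<Sum>n=1..N. e2pi (poly P (real n)) * half_phase k ((tower \<alpha> ^^ n) x)) / of_nat N) \<longlonglongrightarrow> 0"
  proof
    assume "(\<lambda>N. (\<Sum>n=1..N. e2pi (poly P (real n)) * half_phase k ((tower \<alpha> ^^ n) x)) / of_nat N) \<longlonglongrightarrow> 0"
    then have "(\<lambda>N. (\<Sum>n=1..N. g n) / of_nat N) \<longlonglongrightarrow> 0" by (simp add: g_def)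
    \<comment> \<open>Even \<open>N\<close> only, starting from 2 so that no division by 0
      occurs.\<close>
    from LIMSEQ_subseq_LIMSEQ[OF this, of "\<lambda>L. 2 * Suc L"]
    have "(\<lambda>L. (\<Sum>n=1..2 * Suc L. g n) / of_nat (2 * Suc L)) \<longlonglongrightarrow> 0"
      by (simp add: strict_mono_def o_def)
    moreover have "(\<Sum>n=1..2 * Suc L. g n) / of_nat (2 * Suc L) = 1/2" for L
    proof -
      have "complex_of_nat (Suc L) \<noteq> 0" by (simp del: of_nat_Suc)
      then show ?thesis unfolding sum by (simp del: of_nat_Suc mult_Suc_right)
    qed
    ultimately have "(\<lambda>L::nat. 1/2 :: complex) \<longlonglongrightarrow> 0" by (simp only:)
    then show False by (simp add: LIMSEQ_const_iff)
  qed
qed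

lemma irrational_exists: "\<exists>\<alpha>::real. \<alpha> \<notin> \<rat>"
  using uncountable_UNIV_real countable_rat by (metis UNIV_eq_I)

theorem theorem1p3:
  shows "(\<forall>k::nat. k \<ge> 2 \<longrightarrow>
           (\<exists>(M :: (nat \<Rightarrow> real) measure) T.
              ergodic M T \<and> E_perp M k T \<noteq> E_perp M k (T ^^ 2)))
       \<and> (\<forall>k::nat. k \<ge> 2 \<longrightarrow>
           (\<exists>(M :: (nat \<Rightarrow> real) measure) T f.
              ergodic M T \<and> \<not> totally_ergodic M T \<and> Linfty M f \<and> f \<in> E_perp M k T \<and>
              \<not> (AE x in M. \<forall>\<phi> (P :: real poly). torus_cont \<phi> \<and> degree P \<le> k \<longrightarrow>
                   (\<lambda>N. (\<Sum>n=1..N. \<phi> (poly P (real n)) * f ((T ^^ n) x)) / of_nat N)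
                     \<longlonglongrightarrow> 0)))"
proof -
  obtain \<alpha> :: real where irr: "\<alpha> \<notin> \<rat>" using irrational_exists by blast
  show ?thesis
  proof (intro conjI allI impI)
    fix k :: nat assume k: "k \<ge> 2"
    then have "E_perp tower_space k (tower \<alpha>) \<noteq> E_perp tower_space k (tower \<alpha> ^^ 2)"
      using half_phase_E_perp[OF irr k] half_phase_not_E_perp[of k \<alpha>] by fastforce
    then show "\<exists>(M :: (nat \<Rightarrow> real) measure) T. ergodic M T \<and> E_perp M k T \<noteq> E_perp M k (T ^^ 2)"
      using ergodic_tower[OF irr] by blast
  next
    fix k :: nat assume k: "k \<ge> 2"
    let ?T = "tower \<alpha>" and ?f = "half_phase k"
    have "Linfty tower_space ?f"
      unfolding Linfty_def using norm_half_phase measurable_half_phase by blast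
    moreover have "\<not> (AE x in tower_space. \<forall>\<phi> (P :: real poly). torus_cont \<phi> \<and> degree P \<le> k \<longrightarrow>
        (\<lambda>N. (\<Sum>n=1..N. \<phi> (poly P (real n)) * ?f ((?T ^^ n) x)) / of_nat N) \<longlonglongrightarrow> 0)"
    proof
      note [measurable] = tower_coordinate_measurable
      assume "AE x in tower_space. \<forall>\<phi> (P :: real poly). torus_cont \<phi> \<and> degree P \<le> k \<longrightarrow>
        (\<lambda>N. (\<Sum>n=1..N. \<phi> (poly P (real n)) * ?f ((?T ^^ n) x)) / of_nat N) \<longlonglongrightarrow> 0"
      moreover have "torus_cont e2pi"
        using continuous_on_e2pi[OF continuous_on_id] e2pi_of_int[of 1]
        by (simp add: torus_cont_def e2pi_add)
      \<comment> \<open>Every point of the lower floor violates the limit for \<open>e2pi\<close>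
        and a \<open>P\<close> depending on the point, so that floor would have to be a null
        set.\<close>
      ultimately have "AE x in tower_space. x \<notin> {x \<in> space tower_space. x 0 = 0}"
      proof (elim eventually_mono, intro notI)
        fix x assume *: "\<forall>\<phi> (P :: real poly). torus_cont \<phi> \<and> degree P \<le> k \<longrightarrow>
            (\<lambda>N. (\<Sum>n=1..N. \<phi> (poly P (real n)) * ?f ((?T ^^ n) x)) / of_nat N) \<longlonglongrightarrow> 0"
          and "x \<in> {x \<in> space tower_space. x 0 = 0}"
        then have x: "x \<in> space tower_space" "x 0 = 0" by auto
        from k have "k \<ge> 1" by simp
        then obtain P :: "real poly" where "degree P \<le> k"
          "\<not> (\<lambda>N. (\<Sum>n=1..N. e2pi (poly P (real n)) * ?f ((?T ^^ n) x)) / of_nat N) \<longlonglongrightarrow> 0"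
          using half_phase_averages[OF _ x] by blast
        with * \<open>torus_cont e2pi\<close> show False by blast
      qed
      then have "measure tower_space {x \<in> space tower_space. x 0 = 0} = 0"
        by (subst tower_space.prob_eq_0) auto
      then show False using measure_lower_half by simp
    qed
    ultimately show "\<exists>(M :: (nat \<Rightarrow> real) measure) T f.
       ergodic M T \<and> \<not> totally_ergodic M T \<and> Linfty M f \<and> f \<in> E_perp M k T \<and>
       \<not> (AE x in M. \<forall>\<phi> (P :: real poly). torus_cont \<phi> \<and> degree P \<le> k \<longrightarrow>
            (\<lambda>N. (\<Sum>n=1..N. \<phi> (poly P (real n)) * f ((T ^^ n) x)) / of_nat N) \<longlonglongrightarrow> 0)"
      using ergodic_tower[OF irr] not_totally_ergodic_tower half_phase_E_perp[OF irr k] by blast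
  qed
qed

end
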